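(* Let $v\in\mathbb{R}$, let $N$ be a positive integer, and let $a_0,a_1,\dots,a_{2N-1}$ be arbitrary complex constants. For $n\in\{0,1\}$ and positive integers $r,s$ define $$ m_{r,s}^{(n)}=\left.\sum_{k=0}^{r}\frac{a_k}{(r-k)!}\,\bigl(p\,\partial_p+\xi+n\bigr)^{r-k}\;\sum_{l=0}^{s}\frac{\overline{a}_l}{(s-l)!}\,\bigl(q\,\partial_q+\eta-n\bigr)^{s-l}\;\frac{1}{p+q}\right|_{p=1,\;q=1}, $$ where $$ \xi=p\,x+\bigl(2\mathrm{i}p^{2}-3vp^{3}-3vp\bigr)t,\qquad \eta=q\,x-\bigl(2\mathrm{i}q^{2}+3vq^{3}+3vq\bigr)t, $$ and let $$ \tau_n=\det_{1\le r,s\le N}\bigl(m^{(n)}_{2r-1,\,2s-1}\bigr),\qquad n=0,1. $$ Then $$ \phi_N(x,t)=e^{2\mathrm{i}t}\,\frac{\tau_1}{\tau_0} $$ is a (rational-type) solution of the Hirota equation $$ \mathrm{i}\phi_t+\phi_{xx}+2|\phi|^2\phi+\mathrm{i}v\,\phi_{xxx}+6\mathrm{i}v\,|\phi|^2\phi_x=0 $$ at every point $(x,t)\in\mathbb{R}^2$ where $\tau_0\neq 0$.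
   Context: Here $\mathrm{i}=\sqrt{-1}$ and the bar denotes complex conjugation. In the definition of $m^{(n)}_{r,s}$, $p,q$ are auxiliary variables; $\xi$ (a function of $p,x,t$) and $\eta$ (a function of $q,x,t$) act by multiplication, $\partial_p,\partial_q$ are partial derivatives, the operator powers $(p\partial_p+\xi+n)^{r-k}$ and $(q\partial_q+\eta-n)^{s-l}$ are applied to the function $1/(p+q)$, and the result is evaluated at $p=q=1$. The indices $r,s$ of the matrix entries are positive integers (distinct from the imaginary unit). *)

theory Defs
  imports "HOL-Analysis.Derivative" "Jordan_Normal_Form.Determinant"
begin

text \<open>Auxiliary variables p, q are complex; partial derivatives in p, q are complex derivatives
  (all functions involved are holomorphic near p = q = 1).\<close>

definition xi :: "real \<Rightarrow> complex \<Rightarrow> real \<Rightarrow> real \<Rightarrow> complex" where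
  "xi v p x t = p * of_real x + (2 * \<i> * p^2 - 3 * of_real v * p^3 - 3 * of_real v * p) * of_real t"

definition eta :: "real \<Rightarrow> complex \<Rightarrow> real \<Rightarrow> real \<Rightarrow> complex" where
  "eta v q x t = q * of_real x - (2 * \<i> * q^2 + 3 * of_real v * q^3 + 3 * of_real v * q) * of_real t"

definition opP :: "real \<Rightarrow> nat \<Rightarrow> real \<Rightarrow> real \<Rightarrow> (complex \<Rightarrow> complex \<Rightarrow> complex) \<Rightarrow> (complex \<Rightarrow> complex \<Rightarrow> complex)" where
  "opP v n x t f = (\<lambda>p q. p * deriv (\<lambda>p'. f p' q) p + (xi v p x t + of_nat n) * f p q)"

definition opQ :: "real \<Rightarrow> nat \<Rightarrow> real \<Rightarrow> real \<Rightarrow> (complex \<Rightarrow> complex \<Rightarrow> complex) \<Rightarrow> (complex \<Rightarrow> complex \<Rightarrow> complex)" where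
  "opQ v n x t f = (\<lambda>p q. q * deriv (\<lambda>q'. f p q') q + (eta v q x t - of_nat n) * f p q)"

definition mEntry :: "real \<Rightarrow> (nat \<Rightarrow> complex) \<Rightarrow> nat \<Rightarrow> nat \<Rightarrow> nat \<Rightarrow> real \<Rightarrow> real \<Rightarrow> complex" where
  "mEntry v a n r s x t =
     (\<Sum>k=0..r. a k / of_nat (fact (r - k)) *
        ((opP v n x t ^^ (r - k))
           (\<lambda>p q. \<Sum>l=0..s. cnj (a l) / of_nat (fact (s - l)) *
                 ((opQ v n x t ^^ (s - l)) (\<lambda>p' q'. 1 / (p' + q'))) p q)) 1 1)"

text \<open>tau_n = det_{1<=r,s<=N} m^{(n)}_{2r-1,2s-1}; with 0-based indices i,j, 2r-1 = 2i+1.\<close>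
definition tau :: "real \<Rightarrow> (nat \<Rightarrow> complex) \<Rightarrow> nat \<Rightarrow> nat \<Rightarrow> real \<Rightarrow> real \<Rightarrow> complex" where
  "tau v a N n x t = Determinant.det (mat N N (\<lambda>(i, j). mEntry v a n (2 * i + 1) (2 * j + 1) x t))"

definition phiN :: "real \<Rightarrow> (nat \<Rightarrow> complex) \<Rightarrow> nat \<Rightarrow> real \<Rightarrow> real \<Rightarrow> complex" where
  "phiN v a N x t = exp (2 * \<i> * of_real t) * tau v a N 1 x t / tau v a N 0 x t"

definition Dx :: "(real \<Rightarrow> real \<Rightarrow> complex) \<Rightarrow> real \<Rightarrow> real \<Rightarrow> complex" where
  "Dx f x t = vector_derivative (\<lambda>y. f y t) (at x)"

definition Dt :: "(real \<Rightarrow> real \<Rightarrow> complex) \<Rightarrow> real \<Rightarrow> real \<Rightarrow> complex" where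
  "Dt f x t = vector_derivative (\<lambda>s. f x s) (at t)"

end

theory Submission
  imports Defs "HOL-Analysis.FPS_Convergence"
begin

text \<open>
  Put \<open>p = e\<^sup>\<kappa>\<close>, \<open>q = e\<^sup>\<lambda>\<close>. Since \<open>p \<partial>\<^sub>p + \<xi>\<close> is \<open>\<partial>\<^sub>\<kappa>\<close> conjugated by \<open>e\<^bsup>\<zeta>\<^esup>\<close> with \<open>p \<zeta>' = \<xi>\<close>, the
  entry \<open>m\<^sup>(\<^sup>n\<^sup>)\<^sub>r\<^sub>s\<close> is, up to a common factor, the coefficient of \<open>\<kappa>\<^sup>r \<lambda>\<^sup>s\<close> in
  \<open>(p/q)\<^sup>n A(\<kappa>) B(\<lambda>) / (p + q)\<close>. Let \<open>M\<close> be the matrix for \<open>n = 0\<close>, and let \<open>\<phi>\<^sub>k\<close>, \<open>\<psi>\<^sub>k\<close> be the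
  vectors of odd coefficients of \<open>p\<^sup>k A\<close>, \<open>q\<^sup>k B\<close>. From \<open>p/q = (p + q)/q - 1\<close> the matrix for \<open>n = 1\<close> is
  minus a rank-one perturbation of \<open>M\<close>, so \<open>\<tau>\<^sub>1/\<tau>\<^sub>0 = \<plusminus> (1 - S\<^sub>-\<^sub>1\<^sub>,\<^sub>0)\<close> where \<open>S\<^sub>j\<^sub>k = \<psi>\<^sub>j\<^sup>T M\<^sup>-\<^sup>1 \<phi>\<^sub>k\<close>.

  The derivatives \<open>M\<^sub>x\<close>, \<open>M\<^sub>t\<close> are combinations of the \<open>\<phi>\<^sub>j \<psi>\<^sub>k\<^sup>T\<close>, so all derivatives of \<open>S\<^sub>j\<^sub>k\<close> are polynomials
  in the \<open>S\<^sub>j\<^sub>k\<close>. As \<open>p + 1/p\<close> is even in \<open>\<kappa>\<close>, multiplication by it preserves the odd coefficients and acts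
  on them by a matrix \<open>C\<close>; hence \<open>C M + M C\<^sup>T = \<phi>\<^sub>0 \<psi>\<^sub>0\<^sup>T + \<phi>\<^sub>-\<^sub>1 \<psi>\<^sub>-\<^sub>1\<^sup>T\<close>, which gives
  \<open>S\<^sub>j\<^sub>,\<^sub>k\<^sub>+\<^sub>1 + S\<^sub>j\<^sub>,\<^sub>k\<^sub>-\<^sub>1 + S\<^sub>j\<^sub>+\<^sub>1\<^sub>,\<^sub>k + S\<^sub>j\<^sub>-\<^sub>1\<^sub>,\<^sub>k = S\<^sub>j\<^sub>,\<^sub>0 S\<^sub>0\<^sub>,\<^sub>k + S\<^sub>j\<^sub>,\<^sub>-\<^sub>1 S\<^sub>-\<^sub>1\<^sub>,\<^sub>k\<close>. Since \<open>M\<close> is Hermitian, the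
  conjugate of \<open>S\<^sub>-\<^sub>1\<^sub>,\<^sub>0\<close> is \<open>S\<^sub>0\<^sub>,\<^sub>-\<^sub>1\<close>, and the Hirota equation becomes a polynomial identity modulo the
  relations for \<open>j = 0\<close> and \<open>k = 0, 1\<close>.
\<close>

section \<open>The pairing with the Cauchy kernel\<close>

text \<open>
  In the variables \<open>p = e\<^sup>\<kappa>\<close>, \<open>q = e\<^sup>\<lambda>\<close> the inner series is in \<open>\<kappa>\<close> and the outer one in \<open>\<lambda>\<close>;
  \<open>cauchy_kernel\<close> is the expansion of \<open>1 / (p + q)\<close>.
\<close>

definition lift :: "complex fps \<Rightarrow> complex fps fps" where
  "lift B = Abs_fps (\<lambda>j. fps_const (fps_nth B j))"

definition cauchy_kernel :: "complex fps fps" where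
  "cauchy_kernel = fps_right_inverse (fps_const (fps_exp 1) + lift (fps_exp 1)) (inverse (fps_exp 1 + 1))"

text \<open>The coefficient of \<kappa>^r \<lambda>^s in A(\<kappa>) B(\<lambda>) / (p + q).\<close>

definition pair :: "complex fps \<Rightarrow> complex fps \<Rightarrow> nat \<Rightarrow> nat \<Rightarrow> complex" where
  "pair A B r s = fps_nth (fps_nth (fps_const A * lift B * cauchy_kernel) s) r"

lemma lift_nth [simp]: "fps_nth (lift B) j = fps_const (fps_nth B j)"
  by (simp add: lift_def)

lemma lift_mult: "lift (A * B) = lift A * lift B"
proof (rule fps_ext)
  fix n
  have "fps_const (\<Sum>i\<in>I. f i) = (\<Sum>i\<in>I. fps_const (f i))" for f :: "nat \<Rightarrow> complex" and I
    by (induction I rule: infinite_finite_induct) (auto simp flip: fps_const_add)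
  then show "fps_nth (lift (A * B)) n = fps_nth (lift A * lift B) n"
    by (simp add: fps_mult_nth)
qed

lemma lift_add: "lift (A + B) = lift A + lift B"
  by (rule fps_ext) simp

text \<open>The leading coefficient in \<lambda> is e^\<kappa> + 1, whose constant term 2 makes it a
  unit. The coefficient ring is not a field, so \<open>fps_right_inverse\<close> is given the
  inverse of this unit explicitly.\<close>

lemma cauchy_kernel_inverse: "(fps_const (fps_exp 1) + lift (fps_exp 1)) * cauchy_kernel = 1"
  unfolding cauchy_kernel_def
  by (rule fps_right_inverse) (simp add: inverse_mult_eq_1')

text \<open>The factors e^\<kappa> and e^\<lambda> add up to p + q, which cancels the kernel. Every
  rank-one matrix below arises in this way.\<close>

lemma pair_exp: "pair (fps_exp 1 * A) B r s + pair A (fps_exp 1 * B) r s = fps_nth A r * fps_nth B s"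
proof -
  have "fps_const (fps_exp 1 * A) * lift B * cauchy_kernel + fps_const A * lift (fps_exp 1 * B) * cauchy_kernel
      = fps_const A * lift B * ((fps_const (fps_exp 1) + lift (fps_exp 1)) * cauchy_kernel)"
    by (simp add: lift_mult algebra_simps flip: fps_const_mult)
  also have "\<dots> = fps_const A * lift B"
    by (simp add: cauchy_kernel_inverse)
  finally have "fps_nth (fps_nth (fps_const (fps_exp 1 * A) * lift B * cauchy_kernel + fps_const A * lift (fps_exp 1 * B) * cauchy_kernel) s) r
     = fps_nth (fps_nth (fps_const A * lift B) s) r"
    by simp
  then show ?thesis
    by (simp add: pair_def)
qed

lemma pair_add_left: "pair (A + A') B r s = pair A B r s + pair A' B r s"
  by (simp add: pair_def algebra_simps flip: fps_const_add)

lemma pair_add_right: "pair A (B + B') r s = pair A B r s + pair A B' r s"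
  by (simp add: pair_def algebra_simps lift_add)

lemma pair_left: "pair A B r s = fps_nth (A * fps_nth (lift B * cauchy_kernel) s) r"
  by (simp add: pair_def mult.assoc)

text \<open>With one argument fixed, the pairing is a coefficient of the other argument times a
  fixed series, so facts about coefficients of single products transfer to it.\<close>

lemma pair_right: "pair A B r s = fps_nth (B * Abs_fps (\<lambda>j. fps_nth (A * fps_nth cauchy_kernel j) r)) s"
proof -
  have "fps_const A * lift B * cauchy_kernel = lift B * (fps_const A * cauchy_kernel)"
    by (simp add: ac_simps)
  then have "pair A B r s = fps_nth (fps_nth (lift B * (fps_const A * cauchy_kernel)) s) r"
    by (simp only: pair_def)
  also have "\<dots> = (\<Sum>i=0..s. fps_nth B i * fps_nth (A * fps_nth cauchy_kernel (s - i)) r)"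
    by (simp add: fps_mult_nth[of "lift B"] fps_sum_nth)
  finally show ?thesis
    by (simp add: fps_mult_nth[of B])
qed

lemma pair_sum: "pair A B r s
   = (\<Sum>j=0..s. \<Sum>i=0..r. fps_nth A i * fps_nth B j * fps_nth (fps_nth cauchy_kernel (s - j)) (r - i))"
  by (simp add: pair_right fps_mult_nth sum_distrib_left ac_simps)

lemma cauchy_kernel_recurrence:
  "(\<Sum>a=0..i. fps_nth (fps_nth cauchy_kernel j) (i - a) / fact a) + (\<Sum>b=0..j. fps_nth (fps_nth cauchy_kernel (j - b)) i / fact b)
   = (if i = 0 \<and> j = 0 then 1 else 0)"
proof -
  have "fps_nth (fps_nth ((fps_const (fps_exp 1) + lift (fps_exp 1)) * cauchy_kernel) j) i = fps_nth (fps_nth 1 j) i"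
    by (simp add: cauchy_kernel_inverse)
  then show ?thesis
    by (simp add: distrib_right fps_mult_nth[of "lift _"] fps_mult_nth[of "fps_exp _"] fps_sum_nth)
qed

text \<open>1 / (p + q) is symmetric and real. Isolating the terms a = 0 and b = 0 of the recurrence
  expresses each coefficient by those of smaller i + j, in a way invariant under swapping the
  indices and conjugating.\<close>

lemma cauchy_kernel_cnj: "cnj (fps_nth (fps_nth cauchy_kernel j) i) = fps_nth (fps_nth cauchy_kernel i) j"
proof (induction "i + j" arbitrary: i j rule: less_induct)
  case less
  let ?k = "\<lambda>i j. fps_nth (fps_nth cauchy_kernel j) i"
  have rec: "2 * ?k i j = (if i = 0 \<and> j = 0 then 1 else 0)
     - (\<Sum>a=1..i. ?k (i - a) j / fact a) - (\<Sum>b=1..j. ?k i (j - b) / fact b)" for i j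
    using cauchy_kernel_recurrence[of j i]
    by (simp add: sum.atLeast_Suc_atMost algebra_simps)
  have "cnj (2 * ?k i j) = 2 * ?k j i"
    unfolding rec
    using less.hyps by (auto simp: algebra_simps intro!: arg_cong2[of _ _ _ _ "(+)"] sum.cong)
  then show ?case by simp
qed

lemma pair_cnj: "cnj (pair A B r s) = pair (Abs_fps (\<lambda>n. cnj (fps_nth B n))) (Abs_fps (\<lambda>n. cnj (fps_nth A n))) s r"
  unfolding pair_sum by (subst sum.swap) (simp add: cauchy_kernel_cnj ac_simps)

section \<open>Exponentials of formal power series\<close>

text \<open>The composition is only meaningful for an inner series without constant term, hence the split.\<close>

definition fexp :: "complex fps \<Rightarrow> complex fps" where
  "fexp Z = fps_const (exp (fps_nth Z 0)) * (fps_exp 1 oo (Z - fps_const (fps_nth Z 0)))"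

lemma fexp_nth_0 [simp]: "fps_nth (fexp Z) 0 = exp (fps_nth Z 0)"
  by (simp add: fexp_def)

lemma fexp_deriv [simp]: "fps_deriv (fexp Z) = fps_deriv Z * fexp Z"
  by (simp add: fexp_def fps_compose_deriv)

text \<open>Comparing coefficients in F' = Z' F gives n F_n in terms of earlier coefficients, so the
  initial value determines F.\<close>

lemma fexp_unique:
  assumes "fps_deriv F = fps_deriv Z * F" "fps_nth F 0 = exp (fps_nth Z 0)"
  shows "F = fexp Z"
proof (rule fps_ext)
  fix n
  show "fps_nth F n = fps_nth (fexp Z) n"
  proof (induction n rule: less_induct)
    case (less n)
    show ?case
    proof (cases n)
      case 0
      with assms(2) show ?thesis by simp
    next
      case (Suc m)
      have "of_nat n * fps_nth F n = fps_nth (fps_deriv Z * F) m"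
        using Suc by (simp flip: assms(1))
      also have "\<dots> = fps_nth (fps_deriv Z * fexp Z) m"
        unfolding fps_mult_nth using less.IH Suc by (intro sum.cong) auto
      also have "\<dots> = of_nat n * fps_nth (fexp Z) n"
        using Suc by (simp flip: fexp_deriv)
      finally show ?thesis using Suc by (simp del: of_nat_Suc)
    qed
  qed
qed

text \<open>As p = e^\<kappa>, a term c \<kappa> in the exponent is a factor p^c. This turns the
  shifts by n and -n in the operators into p^n and q^(-n).\<close>

lemma fexp_add_X: "fexp (Z + fps_const c * fps_X) = fps_exp c * fexp Z"
  by (rule fexp_unique[symmetric]) (simp_all add: algebra_simps)

lemma fexp_cnj:
  "Abs_fps (\<lambda>n. cnj (fps_nth (fexp Z) n)) = fexp (Abs_fps (\<lambda>n. cnj (fps_nth Z n)))"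
proof (rule fexp_unique)
  show "fps_deriv (Abs_fps (\<lambda>n. cnj (fps_nth (fexp Z) n)))
    = fps_deriv (Abs_fps (\<lambda>n. cnj (fps_nth Z n))) * Abs_fps (\<lambda>n. cnj (fps_nth (fexp Z) n))"
  proof (rule fps_ext)
    fix n
    have "cnj (fps_nth (fps_deriv (fexp Z)) n) = cnj (fps_nth (fps_deriv Z * fexp Z) n)"
      by simp
    then show "fps_nth (fps_deriv (Abs_fps (\<lambda>n. cnj (fps_nth (fexp Z) n)))) n
      = fps_nth (fps_deriv (Abs_fps (\<lambda>n. cnj (fps_nth Z n))) * Abs_fps (\<lambda>n. cnj (fps_nth (fexp Z) n))) n"
      by (simp add: fps_mult_nth del: fexp_deriv)
  qed
qed (simp add: exp_cnj)

text \<open>Coefficientwise, d/ds e^Z = W e^Z. The relation n F_n = (Z' F)_(n-1) reduces the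
  induction to a finite sum of earlier coefficients.\<close>

lemma fexp_has_vector_derivative:
  fixes W Z0 :: "complex fps"
  defines "Z \<equiv> \<lambda>s::real. Z0 + fps_const (of_real s) * W"
  shows "((\<lambda>s. fps_nth (fexp (Z s)) n) has_vector_derivative fps_nth (W * fexp (Z s)) n) (at s)"
proof (induction n rule: less_induct)
  case (less n)
  have Zd: "((\<lambda>s. fps_nth (Z s) m) has_vector_derivative fps_nth W m) (at s)" for m
    unfolding Z_def by (auto intro!: derivative_eq_intros)
  show ?case
  proof (cases n)
    case 0
    have "((\<lambda>s. exp (fps_nth (Z s) 0)) has_vector_derivative fps_nth W 0 * exp (fps_nth (Z s) 0)) (at s)"
      using field_vector_diff_chain_at[OF Zd DERIV_exp] by (simp add: o_def)
    with 0 show ?thesis by simp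
  next
    case (Suc m)
    have rec: "fps_nth (fexp Y) n = fps_nth (fps_deriv Y * fexp Y) m / of_nat n" for Y
      using Suc by (simp del: of_nat_Suc flip: fexp_deriv)
    have "((\<lambda>s. \<Sum>i=0..m. fps_nth (fps_deriv (Z s)) i * fps_nth (fexp (Z s)) (m - i))
      has_vector_derivative (\<Sum>i=0..m. fps_nth (fps_deriv (Z s)) i * fps_nth (W * fexp (Z s)) (m - i)
        + fps_nth (fps_deriv W) i * fps_nth (fexp (Z s)) (m - i))) (at s)"
      using less.IH Suc Zd
      by (intro has_vector_derivative_sum has_vector_derivative_mult)
        (auto intro!: has_vector_derivative_mult_right simp: less_Suc_eq_le simp del: of_nat_Suc of_nat_add)
    also have "(\<Sum>i=0..m. fps_nth (fps_deriv (Z s)) i * fps_nth (W * fexp (Z s)) (m - i)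
        + fps_nth (fps_deriv W) i * fps_nth (fexp (Z s)) (m - i))
      = fps_nth (fps_deriv (W * fexp (Z s))) m"
    proof -
      \<comment> \<open>The Leibniz terms Z' (W F) + W' F reassemble to (W F)'.\<close>
      have "fps_deriv (W * fexp (Z s)) = fps_deriv (Z s) * (W * fexp (Z s)) + fps_deriv W * fexp (Z s)"
        by (simp add: algebra_simps)
      then show ?thesis
        by (simp only: fps_add_nth fps_mult_nth[of "fps_deriv (Z s)"] fps_mult_nth[of "fps_deriv W"] sum.distrib)
    qed
    finally have "((\<lambda>s. fps_nth (fps_deriv (Z s) * fexp (Z s)) m)
      has_vector_derivative of_nat n * fps_nth (W * fexp (Z s)) n) (at s)"
      by (simp only: fps_mult_nth[of "fps_deriv _"] fps_deriv_nth Suc Suc_eq_plus1)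
    from has_vector_derivative_divide[OF this, of "of_nat n"] show ?thesis
      using Suc by (subst rec) (simp del: of_nat_Suc)
  qed
qed

section \<open>Euler operators in logarithmic coordinates\<close>

definition eulerop :: "(complex \<Rightarrow> complex) \<Rightarrow> (complex \<Rightarrow> complex) \<Rightarrow> complex \<Rightarrow> complex" where
  "eulerop h g = (\<lambda>p. p * deriv g p + h p * g p)"

lemma has_fps_expansion_eventually_eq:
  assumes "f has_fps_expansion F" "\<forall>\<^sub>F z in nhds 0. f z = g z"
  shows "g has_fps_expansion F"
  using assms unfolding has_fps_expansion_def by (auto elim: eventually_elim2)

text \<open>In the coordinate \<kappa> the operator p d/dp is d/d\<kappa>. As \<open>deriv\<close>
  says nothing where no derivative exists, differentiability of g near 1 has to be recovered from
  the expansion of g(e^\<kappa>).\<close>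

lemma has_fps_expansion_eulerop:
  assumes g: "(\<lambda>\<kappa>. g (exp \<kappa>)) has_fps_expansion G"
    and h: "(\<lambda>\<kappa>. h (exp \<kappa>)) has_fps_expansion H"
  shows "(\<lambda>\<kappa>. eulerop h g (exp \<kappa>)) has_fps_expansion fps_deriv G + H * G"
proof -
  let ?g = "\<lambda>\<kappa>. g (exp \<kappa>)"
  define R where "R = fps_conv_radius G"
  have R: "R > 0" and ev: "\<forall>\<^sub>F \<kappa> in nhds 0. eval_fps G \<kappa> = ?g \<kappa>"
    using g by (auto simp: has_fps_expansion_def R_def)
  have "\<forall>\<^sub>F \<kappa> in nhds (0::complex). \<kappa> \<in> eball 0 R"
    using R by (intro eventually_nhds_in_open) (auto simp: zero_ereal_def)
  \<comment> \<open>Radius 1 < pi keeps \<kappa> in the strip where Ln inverts exp, so that g can be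
    written as (g o exp) o Ln near e^\<kappa>.\<close>
  moreover have "\<forall>\<^sub>F \<kappa> in nhds (0::complex). \<kappa> \<in> ball 0 1"
    by (intro eventually_nhds_in_open) auto
  moreover have "\<forall>\<^sub>F \<kappa> in nhds 0. \<forall>\<^sub>F w in nhds \<kappa>. eval_fps G w = ?g w"
    using ev by (simp add: eventually_eventually)
  ultimately have "\<forall>\<^sub>F \<kappa> in nhds 0. exp \<kappa> * deriv g (exp \<kappa>) = deriv ?g \<kappa>"
  proof eventually_elim
    case (elim \<kappa>)
    have "(eval_fps G has_field_derivative eval_fps (fps_deriv G) \<kappa>) (at \<kappa>)"
      using elim(1) by (intro has_field_derivative_eval_fps) (auto simp: R_def)
    then have dg: "(?g has_field_derivative eval_fps (fps_deriv G) \<kappa>) (at \<kappa>)"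
      using DERIV_cong_ev[OF refl elim(3) refl] by blast
    have "\<bar>Im \<kappa>\<bar> < 1"
      using elim(2) abs_Im_le_cmod[of \<kappa>] by simp
    then have Im: "- pi < Im \<kappa>" "Im \<kappa> < pi"
      using pi_gt3 by linarith+
    then have Ln: "Ln (exp \<kappa>) = \<kappa>"
      by (intro Ln_exp) auto
    have "exp \<kappa> \<notin> \<real>\<^sub>\<le>\<^sub>0"
    proof
      assume "exp \<kappa> \<in> \<real>\<^sub>\<le>\<^sub>0"
      then have "Re (exp \<kappa>) \<le> 0" "Im (exp \<kappa>) = 0"
        by (simp_all add: complex_nonpos_Reals_iff)
      moreover have "Re (exp \<kappa>) \<noteq> 0 \<or> Im (exp \<kappa>) \<noteq> 0"
        using exp_not_eq_zero[of \<kappa>] by (metis complex_eq_iff zero_complex.sel)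
      ultimately have "Im (Ln (exp \<kappa>)) = pi"
        using Im_Ln_eq_pi[of "exp \<kappa>"] exp_not_eq_zero[of \<kappa>] by linarith
      with Ln Im show False by simp
    qed
    then have "(Ln has_field_derivative inverse (exp \<kappa>)) (at (exp \<kappa>))"
      by (rule has_field_derivative_Ln)
    moreover have "(?g has_field_derivative eval_fps (fps_deriv G) \<kappa>) (at (Ln (exp \<kappa>)))"
      using dg Ln by simp
    ultimately have D: "((\<lambda>p. g (exp (Ln p))) has_field_derivative eval_fps (fps_deriv G) \<kappa> * inverse (exp \<kappa>)) (at (exp \<kappa>))"
      by (rule DERIV_chain2[rotated])
    have "\<forall>\<^sub>F p in nhds (exp \<kappa>). p \<in> - {0}"
      by (intro eventually_nhds_in_open) auto
    then have ev': "\<forall>\<^sub>F p in nhds (exp \<kappa>). g (exp (Ln p)) = g p"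
      by eventually_elim simp
    have "(g has_field_derivative eval_fps (fps_deriv G) \<kappa> * inverse (exp \<kappa>)) (at (exp \<kappa>))"
      using DERIV_cong_ev[OF refl ev' refl] D by simp
    then have "exp \<kappa> * deriv g (exp \<kappa>) = eval_fps (fps_deriv G) \<kappa>"
      by (simp add: DERIV_imp_deriv)
    also have "\<dots> = deriv ?g \<kappa>"
      using dg by (simp add: DERIV_imp_deriv)
    finally show ?case .
  qed
  then have "\<forall>\<^sub>F \<kappa> in nhds 0. deriv ?g \<kappa> + h (exp \<kappa>) * ?g \<kappa> = eulerop h g (exp \<kappa>)"
    by eventually_elim (simp add: eulerop_def)
  moreover have "(\<lambda>\<kappa>. deriv ?g \<kappa> + h (exp \<kappa>) * ?g \<kappa>) has_fps_expansion fps_deriv G + H * G"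
    by (intro fps_expansion_intros g h)
  ultimately show ?thesis
    by (rule has_fps_expansion_eventually_eq[rotated])
qed

text \<open>Conjugation by e^Z turns d/d\<kappa> + Z' into d/d\<kappa>. The m-th derivative at
  \<kappa> = 0 is m! times a coefficient, and this m! cancels the factorials in
  \<open>mEntry\<close>.\<close>

lemma eulerop_power:
  assumes g: "(\<lambda>\<kappa>. g (exp \<kappa>)) has_fps_expansion G"
    and h: "(\<lambda>\<kappa>. h (exp \<kappa>)) has_fps_expansion fps_deriv Z"
  shows "(eulerop h ^^ m) g 1 * exp (fps_nth Z 0) = fact m * fps_nth (fexp Z * G) m"
proof -
  have "\<exists>P. (\<lambda>\<kappa>. (eulerop h ^^ m) g (exp \<kappa>)) has_fps_expansion P \<and> fexp Z * P = (fps_deriv ^^ m) (fexp Z * G)"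
  proof (induction m)
    case 0
    then show ?case using g by auto
  next
    case (Suc m)
    then obtain P where P: "(\<lambda>\<kappa>. (eulerop h ^^ m) g (exp \<kappa>)) has_fps_expansion P"
      "fexp Z * P = (fps_deriv ^^ m) (fexp Z * G)" by blast
    have "fexp Z * (fps_deriv P + fps_deriv Z * P) = fps_deriv (fexp Z * P)"
      by (simp add: algebra_simps)
    with has_fps_expansion_eulerop[OF P(1) h] P(2) show ?case
      by (auto intro!: exI[of _ "fps_deriv P + fps_deriv Z * P"])
  qed
  then obtain P where P: "(\<lambda>\<kappa>. (eulerop h ^^ m) g (exp \<kappa>)) has_fps_expansion P"
    "fexp Z * P = (fps_deriv ^^ m) (fexp Z * G)" by blast
  have "(eulerop h ^^ m) g 1 = fps_nth P 0"
    using P(1) eventually_nhds_x_imp_x[of "\<lambda>z. eval_fps P z = (eulerop h ^^ m) g (exp z)" 0]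
    by (simp add: has_fps_expansion_def eval_fps_at_0)
  moreover have "fps_nth (fexp Z * P) 0 = fact m * fps_nth (fexp Z * G) m"
  proof -
    have "(fps_deriv ^^ m) F = fps_nth_deriv m F" for F :: "complex fps"
      by (induction m arbitrary: F) (simp_all add: fps_nth_deriv_commute del: fps_nth_deriv.simps(2))
    then show ?thesis
      by (simp add: P(2) fps_deriv_maclauren_0)
  qed
  ultimately show ?thesis
    by (simp add: mult.commute)
qed

text \<open>Expanding 1 / (p + q) in \<lambda> at fixed p and then in \<kappa> gives the formal
  kernel: both sides obey the recursion from (p + q) K = 1, as long as e^\<kappa> is not -1.\<close>

lemma cauchy_kernel_expansion:
  "(\<lambda>\<kappa>. fps_nth (inverse (fps_const (exp \<kappa>) + fps_exp 1)) j) has_fps_expansion fps_nth cauchy_kernel j"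
proof (induction j rule: less_induct)
  case (less j)
  let ?k = "\<lambda>p j. fps_nth (inverse (fps_const p + fps_exp 1)) j :: complex"
  let ?d = "if j = 0 then 1 else 0"
  have k: "(p + 1) * ?k p j = ?d - (\<Sum>b=1..j. 1 / fact b * ?k p (j - b))" if "p + 1 \<noteq> 0" for p :: complex
  proof -
    have "(fps_const p + fps_exp 1) * inverse (fps_const p + fps_exp 1) = 1"
      using that by (intro inverse_mult_eq_1') simp
    then have "fps_nth ((fps_const p + fps_exp 1) * inverse (fps_const p + fps_exp 1)) j = ?d"
      by simp
    then have "p * ?k p j + (\<Sum>b=0..j. 1 / fact b * ?k p (j - b)) = ?d"
      by (simp add: distrib_right fps_mult_nth[of "fps_exp 1"])
    then show ?thesis
      by (simp add: sum.atLeast_Suc_atMost algebra_simps)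
  qed
  have "(fps_exp 1 + 1) * fps_nth cauchy_kernel j
      = fps_const ?d - (\<Sum>b=1..j. fps_const (1 / fact b) * fps_nth cauchy_kernel (j - b))"
  proof -
    have "fps_nth ((fps_const (fps_exp 1) + lift (fps_exp 1)) * cauchy_kernel) j = fps_const ?d"
      by (simp add: cauchy_kernel_inverse)
    then have "fps_exp 1 * fps_nth cauchy_kernel j
      + (\<Sum>b=0..j. fps_const (1 / fact b) * fps_nth cauchy_kernel (j - b)) = fps_const ?d"
      by (simp add: distrib_right fps_mult_nth[of "lift _"])
    then show ?thesis
      by (simp add: sum.atLeast_Suc_atMost algebra_simps)
  qed
  then have "inverse (fps_exp 1 + 1) * ((fps_exp 1 + 1) * fps_nth cauchy_kernel j)
      = inverse (fps_exp 1 + 1) * (fps_const ?d - (\<Sum>b=1..j. fps_const (1 / fact b) * fps_nth cauchy_kernel (j - b)))"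
    by simp
  then have K: "fps_nth cauchy_kernel j
      = inverse (fps_exp 1 + 1) * (fps_const ?d - (\<Sum>b=1..j. fps_const (1 / fact b) * fps_nth cauchy_kernel (j - b)))"
    by (simp add: inverse_mult_eq_1 flip: mult.assoc)
  have "(\<lambda>\<kappa>. inverse (exp \<kappa> + 1) * (?d - (\<Sum>b=1..j. 1 / fact b * ?k (exp \<kappa>) (j - b))))
      has_fps_expansion fps_nth cauchy_kernel j"
    unfolding K by (intro fps_expansion_intros less.IH) auto
  moreover have "open (exp -` (- {-1}) :: complex set)"
    by (intro open_vimage continuous_on_exp continuous_on_id) auto
  then have "\<forall>\<^sub>F \<kappa> in nhds (0::complex). \<kappa> \<in> exp -` (- {-1})"
    by (intro eventually_nhds_in_open) auto
  then have "\<forall>\<^sub>F \<kappa> in nhds 0. inverse (exp \<kappa> + 1) * (?d - (\<Sum>b=1..j. 1 / fact b * ?k (exp \<kappa>) (j - b))) = ?k (exp \<kappa>) j"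
  proof eventually_elim
    case (elim \<kappa>)
    then have "exp \<kappa> + 1 \<noteq> 0"
      by (simp add: eq_neg_iff_add_eq_0)
    with k[of "exp \<kappa>"] show ?case
      by (simp add: field_simps)
  qed
  ultimately show ?case
    by (rule has_fps_expansion_eventually_eq)
qed

lemma opP_power: "(\<lambda>p. (opP v n x t ^^ m) F p q) = (eulerop (\<lambda>p. xi v p x t + of_nat n) ^^ m) (\<lambda>p. F p q)"
proof -
  have "(\<lambda>p. opP v n x t G p q) = eulerop (\<lambda>p. xi v p x t + of_nat n) (\<lambda>p. G p q)" for G
    by (simp add: opP_def eulerop_def)
  then show ?thesis
    by (induction m) simp_all
qed

lemma opQ_power: "(opQ v n x t ^^ m) F p = (eulerop (\<lambda>q. eta v q x t - of_nat n) ^^ m) (F p)"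
proof -
  have "opQ v n x t G p = eulerop (\<lambda>q. eta v q x t - of_nat n) (G p)" for G
    by (simp add: opQ_def eulerop_def)
  then show ?thesis
    by (induction m) simp_all
qed

text \<open>\<open>eulerop_power\<close> is applied first in q at fixed p, then in p. The sums over
  l and k are Cauchy products with the series of b and a.\<close>

lemma eulerop_sum_pair:
  assumes hP: "(\<lambda>\<kappa>. hP (exp \<kappa>)) has_fps_expansion fps_deriv ZP"
    and hQ: "(\<lambda>\<kappa>. hQ (exp \<kappa>)) has_fps_expansion fps_deriv ZQ"
  shows "(\<Sum>k=0..r. a k / fact (r - k) * (eulerop hP ^^ (r - k))
      (\<lambda>p. \<Sum>l=0..s. b l / fact (s - l) * (eulerop hQ ^^ (s - l)) (\<lambda>q. 1 / (p + q)) 1) 1)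
      * (exp (fps_nth ZP 0) * exp (fps_nth ZQ 0))
    = pair (Abs_fps a * fexp ZP) (Abs_fps b * fexp ZQ) r s"
proof -
  define B where "B = Abs_fps b * fexp ZQ"
  define c where "c = exp (fps_nth ZQ 0)"
  have c: "c \<noteq> 0" by (simp add: c_def)
  define g where "g = (\<lambda>p. \<Sum>l=0..s. b l / fact (s - l) * (eulerop hQ ^^ (s - l)) (\<lambda>q. 1 / (p + q)) 1)"
  let ?inv = "\<lambda>p. inverse (fps_const p + fps_exp 1)"
  have g: "g p = fps_nth (B * ?inv p) s * inverse c" if "p \<noteq> - 1" for p
  proof -
    have "(\<lambda>\<kappa>. inverse (p + exp \<kappa>)) has_fps_expansion ?inv p"
      using that by (intro fps_expansion_intros) (auto simp: eq_neg_iff_add_eq_0)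
    then have "(\<lambda>\<kappa>. 1 / (p + exp \<kappa>)) has_fps_expansion ?inv p"
      by (simp add: inverse_eq_divide)
    from eulerop_power[OF this hQ]
    have "g p * c = (\<Sum>l=0..s. b l * fps_nth (fexp ZQ * ?inv p) (s - l))"
      unfolding g_def c_def sum_distrib_right by (intro sum.cong) (simp_all add: mult.assoc)
    also have "\<dots> = fps_nth (B * ?inv p) s"
      by (simp add: B_def mult.assoc fps_mult_nth[of "Abs_fps b"])
    finally show ?thesis using c by (simp add: field_simps)
  qed
  have "(\<lambda>\<kappa>. (\<Sum>i=0..s. fps_nth B i * fps_nth (?inv (exp \<kappa>)) (s - i)) * inverse c)
      has_fps_expansion (\<Sum>i=0..s. fps_const (fps_nth B i) * fps_nth cauchy_kernel (s - i)) * fps_const (inverse c)"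
    by (intro fps_expansion_intros cauchy_kernel_expansion)
  moreover have "open (exp -` (- {-1}) :: complex set)"
    by (intro open_vimage continuous_on_exp continuous_on_id) auto
  then have "\<forall>\<^sub>F \<kappa> in nhds (0::complex). \<kappa> \<in> exp -` (- {-1})"
    by (intro eventually_nhds_in_open) auto
  then have "\<forall>\<^sub>F \<kappa> in nhds 0. (\<Sum>i=0..s. fps_nth B i * fps_nth (?inv (exp \<kappa>)) (s - i)) * inverse c = g (exp \<kappa>)"
    by eventually_elim (simp add: g fps_mult_nth)
  ultimately have "(\<lambda>\<kappa>. g (exp \<kappa>)) has_fps_expansion fps_nth (lift B * cauchy_kernel) s * fps_const (inverse c)"
    by (auto simp: fps_mult_nth[of "lift B"] intro: has_fps_expansion_eventually_eq)
  from eulerop_power[OF this hP]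
  have "(\<Sum>k=0..r. a k / fact (r - k) * (eulerop hP ^^ (r - k)) g 1) * exp (fps_nth ZP 0)
    = (\<Sum>k=0..r. a k * fps_nth (fexp ZP * (fps_nth (lift B * cauchy_kernel) s * fps_const (inverse c))) (r - k))"
    unfolding sum_distrib_right by (intro sum.cong) (simp_all add: mult.assoc)
  also have "\<dots> = fps_nth (Abs_fps a * (fexp ZP * (fps_nth (lift B * cauchy_kernel) s * fps_const (inverse c)))) r"
    by (simp add: fps_mult_nth[of "Abs_fps a"])
  also have "\<dots> = pair (Abs_fps a * fexp ZP) B r s * inverse c"
    by (simp add: pair_left flip: mult.assoc)
  finally show ?thesis
    using c by (simp add: field_simps g_def c_def B_def)
qed

section \<open>Matrix entries as coefficients of the pairing\<close>

definition zeta :: "complex \<Rightarrow> real \<Rightarrow> real \<Rightarrow> real \<Rightarrow> complex fps" where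
  "zeta c v x t = fps_const (of_real x) * fps_exp 1
     + fps_const (of_real t) * (fps_const c * fps_exp 2 - fps_const (of_real v) * fps_exp 3 - fps_const (3 * of_real v) * fps_exp 1)"

definition wave :: "complex \<Rightarrow> real \<Rightarrow> (nat \<Rightarrow> complex) \<Rightarrow> real \<Rightarrow> real \<Rightarrow> complex fps" where
  "wave c v a x t = Abs_fps a * fexp (zeta c v x t)"

text \<open>\<open>zeta\<close> is an antiderivative in \<kappa> of \<xi> (c = \<i>) or \<eta> (c =
  -\<i>); integrating p^2 and p^3 divides by 2 and 3, whence its coefficients.\<close>

lemma zeta_deriv_expansion:
  "(\<lambda>\<kappa>. exp \<kappa> * of_real x + (2 * c * exp \<kappa>^2 - 3 * of_real v * exp \<kappa>^3 - 3 * of_real v * exp \<kappa>) * of_real t + d)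
     has_fps_expansion fps_deriv (zeta c v x t + fps_const d * fps_X)"
proof -
  have "(\<lambda>\<kappa>. exp \<kappa> * of_real x + (2 * c * exp (2 * \<kappa>) - 3 * of_real v * exp (3 * \<kappa>) - 3 * of_real v * exp \<kappa>) * of_real t + d)
     has_fps_expansion fps_exp 1 * fps_const (of_real x)
       + (fps_const (2 * c) * fps_exp 2 - fps_const (3 * of_real v) * fps_exp 3 - fps_const (3 * of_real v) * fps_exp 1) * fps_const (of_real t) + fps_const d"
    by (intro fps_expansion_intros)
  also have "fps_exp 1 * fps_const (of_real x)
       + (fps_const (2 * c) * fps_exp 2 - fps_const (3 * of_real v) * fps_exp 3 - fps_const (3 * of_real v) * fps_exp 1) * fps_const (of_real t) + fps_const d
     = fps_deriv (zeta c v x t + fps_const d * fps_X)"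
    by (simp add: zeta_def algebra_simps flip: fps_const_mult)
  finally show ?thesis
    by (simp add: exp_double exp_of_nat_mult[of 3, simplified])
qed

text \<open>The exponential factor comes from the constant terms of the exponents. The shifts by n
  have none, so the factor is the same for all r, s and n.\<close>

lemma mEntry_eq_pair:
  "mEntry v a n r s x t * exp (fps_nth (zeta \<i> v x t + zeta (- \<i>) v x t) 0)
    = pair (fps_exp (of_nat n) * wave \<i> v a x t) (fps_exp (- of_nat n) * wave (- \<i>) v (cnj \<circ> a) x t) r s"
proof -
  have P: "(\<lambda>\<kappa>. xi v (exp \<kappa>) x t + of_nat n) has_fps_expansion fps_deriv (zeta \<i> v x t + fps_const (of_nat n) * fps_X)"
    using zeta_deriv_expansion[of x \<i> v t "of_nat n"] by (simp add: xi_def)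
  have Q: "(\<lambda>\<kappa>. eta v (exp \<kappa>) x t - of_nat n) has_fps_expansion fps_deriv (zeta (- \<i>) v x t + fps_const (- of_nat n) * fps_X)"
    using zeta_deriv_expansion[of x "- \<i>" v t "- of_nat n"] by (simp add: eta_def algebra_simps)
  show ?thesis
    using eulerop_sum_pair[OF P Q, of a r "cnj \<circ> a" s]
    unfolding mEntry_def opP_power[THEN fun_cong] opQ_power fexp_add_X
    by (simp add: wave_def exp_add ac_simps)
qed

section \<open>The Gram matrix and its symmetries\<close>

text \<open>\<open>phi \<i> v a k\<close> is \<open>\<phi>\<^sub>k\<close> and \<open>phi (- \<i>) v (cnj \<circ> a) k\<close> is \<open>\<psi>\<^sub>k\<close>; row \<open>i\<close> (from 0) holds the coefficient \<open>2 i + 1\<close>.\<close>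

definition phi :: "complex \<Rightarrow> real \<Rightarrow> (nat \<Rightarrow> complex) \<Rightarrow> int \<Rightarrow> real \<Rightarrow> real \<Rightarrow> nat \<Rightarrow> complex" where
  "phi c v a k x t i = fps_nth (fps_exp (of_int k) * wave c v a x t) (2 * i + 1)"

definition gram :: "real \<Rightarrow> (nat \<Rightarrow> complex) \<Rightarrow> real \<Rightarrow> real \<Rightarrow> nat \<Rightarrow> nat \<Rightarrow> complex" where
  "gram v a x t i j = pair (wave \<i> v a x t) (wave (- \<i>) v (cnj \<circ> a) x t) (2 * i + 1) (2 * j + 1)"

section \<open>Derivatives in x and t\<close>

lemma fps_mult_has_vector_derivative:
  fixes F :: "complex fps"
  assumes "\<And>m. ((\<lambda>s. fps_nth (G s) m) has_vector_derivative fps_nth G' m) (at s)"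
  shows "((\<lambda>s. fps_nth (F * G s) n) has_vector_derivative fps_nth (F * G') n) (at s)"
  unfolding fps_mult_nth by (intro has_vector_derivative_sum has_vector_derivative_mult_right assms)

lemma pair_has_vector_derivative:
  assumes "\<And>m. ((\<lambda>s. fps_nth (A s) m) has_vector_derivative fps_nth A' m) (at s)"
    and "\<And>m. ((\<lambda>s. fps_nth (B s) m) has_vector_derivative fps_nth B' m) (at s)"
  shows "((\<lambda>s. pair (A s) (B s) i j) has_vector_derivative pair A' (B s) i j + pair (A s) B' i j) (at s)"
proof -
  have "((\<lambda>s. pair (A s) (B s) i j) has_vector_derivative
     (\<Sum>l=0..j. \<Sum>k=0..i. (fps_nth (A s) k * fps_nth B' l + fps_nth A' k * fps_nth (B s) l)
        * fps_nth (fps_nth cauchy_kernel (j - l)) (i - k))) (at s)"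
    unfolding pair_sum
    by (intro has_vector_derivative_sum has_vector_derivative_mult_left has_vector_derivative_mult assms)
  then show ?thesis
    by (simp add: pair_sum sum.distrib algebra_simps)
qed

text \<open>The derivative of \<open>zeta c v x t\<close> in t, as \<open>fps_exp 1\<close> is that
  in x.\<close>

definition flow :: "complex \<Rightarrow> real \<Rightarrow> complex fps" where
  "flow c v = fps_const c * fps_exp 2 - fps_const (of_real v) * fps_exp 3 - fps_const (3 * of_real v) * fps_exp 1"

lemma wave_dx: "((\<lambda>x. fps_nth (wave c v a x t) n) has_vector_derivative fps_nth (fps_exp 1 * wave c v a x t) n) (at x)"
proof -
  have "zeta c v x t = fps_const (of_real t) * flow c v + fps_const (of_real x) * fps_exp 1" for x
    by (simp add: zeta_def flow_def)
  then show ?thesis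
    using fps_mult_has_vector_derivative[OF fexp_has_vector_derivative[of "fps_const (of_real t) * flow c v" "fps_exp 1"], of "Abs_fps a" n x]
    by (simp add: wave_def mult.left_commute)
qed

lemma wave_dt: "((\<lambda>t. fps_nth (wave c v a x t) n) has_vector_derivative fps_nth (flow c v * wave c v a x t) n) (at t)"
proof -
  have "zeta c v x t = fps_const (of_real x) * fps_exp 1 + fps_const (of_real t) * flow c v" for t
    by (simp add: zeta_def flow_def)
  then show ?thesis
    using fps_mult_has_vector_derivative[OF fexp_has_vector_derivative[of "fps_const (of_real x) * fps_exp 1" "flow c v"], of "Abs_fps a" n t]
    by (simp add: wave_def mult.left_commute)
qed

lemma fps_exp_shift:
  fixes k :: int
  shows "fps_exp (of_int k) * (fps_exp 1 * F) = fps_exp (of_int (k + 1)) * (F :: complex fps)"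
    "fps_exp (of_int k) * (fps_exp (-1) * F) = fps_exp (of_int (k - 1)) * F"
    "fps_exp (of_int k) * (fps_exp 2 * F) = fps_exp (of_int (k + 2)) * F"
    "fps_exp (of_int k) * (fps_exp 3 * F) = fps_exp (of_int (k + 3)) * F"
  by (simp_all add: mult.assoc[symmetric] flip: fps_exp_add_mult)

lemma phi_dx: "((\<lambda>x. phi c v a k x t i) has_vector_derivative phi c v a (k + 1) x t i) (at x)"
  unfolding phi_def fps_exp_shift(1)[symmetric]
  by (rule fps_mult_has_vector_derivative[OF wave_dx])

lemma phi_dt: "((\<lambda>t. phi c v a k x t i) has_vector_derivative
    c * phi c v a (k + 2) x t i - of_real v * phi c v a (k + 3) x t i - 3 * of_real v * phi c v a (k + 1) x t i) (at t)"
proof -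
  have "c * phi c v a (k + 2) x t i - of_real v * phi c v a (k + 3) x t i - 3 * of_real v * phi c v a (k + 1) x t i
    = fps_nth (fps_exp (of_int k) * (flow c v * wave c v a x t)) (2 * i + 1)"
    unfolding phi_def fps_exp_shift[symmetric] flow_def left_diff_distrib right_diff_distrib
    by (simp add: mult.assoc mult.left_commute[of "fps_exp (of_int k)" "fps_const _"])
  then show ?thesis
    unfolding phi_def by (simp only:) (rule fps_mult_has_vector_derivative[OF wave_dt])
qed

lemma pair_exp_shift:
  "pair (fps_exp (of_int (k + 1)) * A) (fps_exp (of_int l) * B) r s
   + pair (fps_exp (of_int k) * A) (fps_exp (of_int (l + 1)) * B) r s
   = fps_nth (fps_exp (of_int k) * A) r * fps_nth (fps_exp (of_int l) * B) s"
  using pair_exp[of "fps_exp (of_int k) * A" "fps_exp (of_int l) * B" r s]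
  unfolding fps_exp_shift(1)[symmetric] by (simp only: mult.left_commute)

text \<open>Differentiation in x multiplies the generating function by p + q, so the kernel
  cancels.\<close>

lemma gram_dx: "((\<lambda>x. gram v a x t i j) has_vector_derivative
    phi \<i> v a 0 x t i * phi (- \<i>) v (cnj \<circ> a) 0 x t j) (at x)"
  using pair_has_vector_derivative[OF wave_dx wave_dx]
  by (simp add: gram_def phi_def pair_exp)

text \<open>Differentiation in t multiplies by \<i>(p^2 - q^2) - v(p^3 + q^3) - 3v(p + q). The
  quotient by p + q is \<i>(p - q) - v(p^2 - p q + q^2) - 3v, and its six monomials are the six
  terms.\<close>

lemma gram_dt: "((\<lambda>t. gram v a x t i j) has_vector_derivative
    \<i> * (phi \<i> v a 1 x t i * phi (- \<i>) v (cnj \<circ> a) 0 x t j)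
    - \<i> * (phi \<i> v a 0 x t i * phi (- \<i>) v (cnj \<circ> a) 1 x t j)
    - of_real v * (phi \<i> v a 2 x t i * phi (- \<i>) v (cnj \<circ> a) 0 x t j)
    + of_real v * (phi \<i> v a 1 x t i * phi (- \<i>) v (cnj \<circ> a) 1 x t j)
    - of_real v * (phi \<i> v a 0 x t i * phi (- \<i>) v (cnj \<circ> a) 2 x t j)
    - 3 * of_real v * (phi \<i> v a 0 x t i * phi (- \<i>) v (cnj \<circ> a) 0 x t j)) (at t)"
proof -
  define A where "A = wave \<i> v a x t"
  define B where "B = wave (- \<i>) v (cnj \<circ> a) x t"
  define X where "X k l = pair (fps_exp (of_int k) * A) (fps_exp (of_int l) * B) (2 * i + 1) (2 * j + 1)" for k l
  have X: "phi \<i> v a k x t i * phi (- \<i>) v (cnj \<circ> a) l x t j = X (k + 1) l + X k (l + 1)" for k l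
    by (simp only: X_def pair_exp_shift) (simp add: phi_def A_def B_def)
  have P: "pair (flow \<i> v * A) B (2 * i + 1) (2 * j + 1) = \<i> * X 2 0 - of_real v * X 3 0 - 3 * of_real v * X 1 0"
    by (simp add: flow_def left_diff_distrib pair_left X_def mult.assoc)
  have Q: "pair A (flow (- \<i>) v * B) (2 * i + 1) (2 * j + 1) = - \<i> * X 0 2 - of_real v * X 0 3 - 3 * of_real v * X 0 1"
    by (simp add: flow_def left_diff_distrib pair_right X_def mult.assoc)
  \<comment> \<open>The mixed terms \<open>X 1 1\<close>, \<open>X 2 1\<close>, \<open>X 1 2\<close>
    are inserted and cancel: this is the division by p + q.\<close>
  have "pair (flow \<i> v * A) B (2 * i + 1) (2 * j + 1) + pair A (flow (- \<i>) v * B) (2 * i + 1) (2 * j + 1)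
    = \<i> * (X 2 0 + X 1 1) - \<i> * (X 1 1 + X 0 2) - of_real v * (X 3 0 + X 2 1) + of_real v * (X 2 1 + X 1 2)
      - of_real v * (X 1 2 + X 0 3) - 3 * of_real v * (X 1 0 + X 0 1)"
    unfolding P Q by (simp add: algebra_simps)
  then show ?thesis
    using pair_has_vector_derivative[OF wave_dt[of \<i> v a x] wave_dt[of "- \<i>" v "cnj \<circ> a" x], of "2 * i + 1" "2 * j + 1" t]
    by (simp add: gram_def X A_def B_def)
qed

section \<open>Multiplication by p + 1/p on odd coefficients\<close>

definition toeplitz :: "nat \<Rightarrow> nat \<Rightarrow> complex" where
  "toeplitz i l = (if l \<le> i then 2 / fact (2 * (i - l)) else 0)"

text \<open>2 cosh \<kappa> is even, so odd coefficients of the product involve only odd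
  coefficients of F. This is what the restriction of \<tau> to odd indices is for;
  \<open>toeplitz\<close> is the matrix C of the overview.\<close>

lemma odd_coeff_cosh_mult:
  assumes "i < N"
  shows "fps_nth ((fps_exp 1 + fps_exp (-1)) * F) (2 * i + 1) = (\<Sum>l<N. toeplitz i l * fps_nth F (2 * l + 1))"
proof -
  let ?h = "\<lambda>m. fps_nth F m * ((1 + (-1) ^ (2 * i + 1 - m)) / fact (2 * i + 1 - m))"
  have "fps_nth ((fps_exp 1 + fps_exp (-1)) * F) (2 * i + 1) = (\<Sum>m=0..2 * i + 1. ?h m)"
    by (subst mult.commute) (simp add: fps_mult_nth add_divide_distrib)
  also have "\<dots> = sum ?h ((\<lambda>l. 2 * l + 1) ` {..i})"
  proof (intro sum.mono_neutral_right ballI)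
    fix m assume m: "m \<in> {0..2 * i + 1} - (\<lambda>l. 2 * l + 1) ` {..i}"
    have "even m"
    proof (rule ccontr)
      assume "odd m"
      then obtain l where "m = 2 * l + 1" by (auto elim: oddE)
      with m show False by auto
    qed
    with m show "?h m = 0" by auto
  qed auto
  also have "\<dots> = (\<Sum>l\<le>i. toeplitz i l * fps_nth F (2 * l + 1))"
    by (subst sum.reindex) (auto simp: inj_on_def toeplitz_def diff_mult_distrib2 intro!: sum.cong)
  \<comment> \<open>\<open>toeplitz\<close> is lower triangular, so truncation to size N loses
    nothing.\<close>
  also have "\<dots> = (\<Sum>l<N. toeplitz i l * fps_nth F (2 * l + 1))"
    using assms by (intro sum.mono_neutral_left) (auto simp: toeplitz_def)
  finally show ?thesis .
qed

lemma phi_toeplitz: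
  assumes "i < N"
  shows "(\<Sum>l<N. toeplitz i l * phi c v a k x t l) = phi c v a (k + 1) x t i + phi c v a (k - 1) x t i"
  unfolding phi_def odd_coeff_cosh_mult[OF assms, symmetric] fps_exp_shift(1,2)[symmetric]
  by (simp add: distrib_right mult.left_commute[of "fps_exp (of_int k)"])

text \<open>p + 1/p + q + 1/q = (p + q)(1 + 1/(p q)), so the kernel cancels and C M + M C^T is a sum
  of two rank-one terms.\<close>

lemma gram_toeplitz:
  assumes "i < N" "j < N"
  shows "(\<Sum>l<N. toeplitz i l * gram v a x t l j) + (\<Sum>l<N. toeplitz j l * gram v a x t i l)
    = phi \<i> v a 0 x t i * phi (- \<i>) v (cnj \<circ> a) 0 x t j + phi \<i> v a (-1) x t i * phi (- \<i>) v (cnj \<circ> a) (-1) x t j"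
proof -
  define A where "A = wave \<i> v a x t"
  define B where "B = wave (- \<i>) v (cnj \<circ> a) x t"
  have "(\<Sum>l<N. toeplitz i l * gram v a x t l j) = pair ((fps_exp 1 + fps_exp (-1)) * A) B (2 * i + 1) (2 * j + 1)"
    unfolding pair_left mult.assoc odd_coeff_cosh_mult[OF assms(1)] by (simp add: gram_def pair_left A_def B_def)
  moreover have "(\<Sum>l<N. toeplitz j l * gram v a x t i l) = pair A ((fps_exp 1 + fps_exp (-1)) * B) (2 * i + 1) (2 * j + 1)"
    unfolding pair_right mult.assoc odd_coeff_cosh_mult[OF assms(2)] by (simp add: gram_def pair_right A_def B_def)
  moreover have "phi \<i> v a 0 x t i * phi (- \<i>) v (cnj \<circ> a) 0 x t j = pair (fps_exp 1 * A) B (2 * i + 1) (2 * j + 1) + pair A (fps_exp 1 * B) (2 * i + 1) (2 * j + 1)"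
    using pair_exp[of A B] by (simp add: phi_def A_def B_def)
  moreover have "phi \<i> v a (-1) x t i * phi (- \<i>) v (cnj \<circ> a) (-1) x t j
      = pair (fps_exp (-1) * A) B (2 * i + 1) (2 * j + 1) + pair A (fps_exp (-1) * B) (2 * i + 1) (2 * j + 1)"
    using pair_exp_shift[of "-1" A "-1" B "2 * i + 1" "2 * j + 1"] by (simp add: phi_def A_def B_def add.commute)
  ultimately show ?thesis
    by (simp add: distrib_right pair_add_left pair_add_right)
qed

section \<open>Complex conjugation and the matrices for n = 0 and n = 1\<close>

lemma wave_cnj: "cnj (fps_nth (wave c v a x t) n) = fps_nth (wave (cnj c) v (cnj \<circ> a) x t) n"
proof -
  have "Abs_fps (\<lambda>n. cnj (fps_nth (zeta c v x t) n)) = zeta (cnj c) v x t"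
    by (rule fps_ext) (simp add: zeta_def)
  from fexp_cnj[of "zeta c v x t", unfolded this]
  have "cnj (fps_nth (fexp (zeta c v x t)) m) = fps_nth (fexp (zeta (cnj c) v x t)) m" for m
    by (simp add: fps_eq_iff)
  then show ?thesis
    by (simp add: wave_def fps_mult_nth)
qed

lemma phi_cnj: "cnj (phi c v a k x t i) = phi (cnj c) v (cnj \<circ> a) k x t i"
  by (simp add: phi_def fps_mult_nth wave_cnj del: sum.cl_ivl_Suc)

text \<open>As x, t and v are real, conjugation exchanges the two waves; the kernel being symmetric
  and real, M is Hermitian.\<close>

lemma gram_cnj: "cnj (gram v a x t i j) = gram v a x t j i"
  by (simp add: gram_def pair_cnj wave_cnj comp_def fps_nth_inverse)

lemma gram_mEntry_0:
  "mEntry v a 0 (2 * i + 1) (2 * j + 1) x t * exp (fps_nth (zeta \<i> v x t + zeta (- \<i>) v x t) 0) = gram v a x t i j"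
  unfolding mEntry_eq_pair by (simp add: gram_def)

lemma gram_mEntry_1:
  "mEntry v a 1 (2 * i + 1) (2 * j + 1) x t * exp (fps_nth (zeta \<i> v x t + zeta (- \<i>) v x t) 0)
    = phi \<i> v a 0 x t i * phi (- \<i>) v (cnj \<circ> a) (- 1) x t j - gram v a x t i j"
  unfolding mEntry_eq_pair
  \<comment> \<open>With exponents 0 and -1 this is p/q + 1 = (p + q)/q.\<close>
  using pair_exp_shift[of 0 "wave \<i> v a x t" "-1" "wave (- \<i>) v (cnj \<circ> a) x t" "2 * i + 1" "2 * j + 1"]
  by (simp add: gram_def phi_def algebra_simps)

section \<open>Bilinear forms in the inverse matrix\<close>

definition bil :: "nat \<Rightarrow> (nat \<Rightarrow> complex) \<Rightarrow> (nat \<Rightarrow> nat \<Rightarrow> complex) \<Rightarrow> (nat \<Rightarrow> complex) \<Rightarrow> complex" where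
  "bil N \<beta> J \<alpha> = (\<Sum>i<N. \<Sum>j<N. \<beta> i * J i j * \<alpha> j)"

text \<open>The adjugate formula makes each entry a quotient of determinants, hence visibly
  differentiable.\<close>

definition minv :: "nat \<Rightarrow> (nat \<Rightarrow> nat \<Rightarrow> complex) \<Rightarrow> nat \<Rightarrow> nat \<Rightarrow> complex" where
  "minv N M i j = adj_mat (mat N N (\<lambda>(i, j). M i j)) $$ (i, j) / det (mat N N (\<lambda>(i, j). M i j))"

lemma minv_mult:
  assumes "det (mat N N (\<lambda>(i, j). M i j)) \<noteq> 0" "i < N" "j < N"
  shows "(\<Sum>k<N. M i k * minv N M k j) = (if i = j then 1 else 0)"
    and "(\<Sum>k<N. minv N M i k * M k j) = (if i = j then 1 else 0)"
proof -
  let ?A = "mat N N (\<lambda>(i, j). M i j)"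
  have A: "?A \<in> carrier_mat N N" by simp
  note adj = adj_mat[OF A]
  have "(\<Sum>k<N. M i k * adj_mat ?A $$ (k, j)) = (?A * adj_mat ?A) $$ (i, j)"
    using assms(2,3) adj(1) by (auto simp: scalar_prod_def lessThan_atLeast0 intro!: sum.cong)
  then show "(\<Sum>k<N. M i k * minv N M k j) = (if i = j then 1 else 0)"
    using assms by (simp add: minv_def adj(2) flip: sum_divide_distrib)
  have "(\<Sum>k<N. adj_mat ?A $$ (i, k) * M k j) = (adj_mat ?A * ?A) $$ (i, j)"
    using assms(2,3) adj(1) by (auto simp: scalar_prod_def lessThan_atLeast0 intro!: sum.cong)
  then show "(\<Sum>k<N. minv N M i k * M k j) = (if i = j then 1 else 0)"
    using assms by (simp add: minv_def adj(3) flip: sum_divide_distrib)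
qed

text \<open>The conjugate transpose of the inverse is a right inverse of the Hermitian M, hence
  equal to the inverse.\<close>

lemma minv_cnj:
  assumes det: "det (mat N N (\<lambda>(i, j). M i j)) \<noteq> 0" and M: "\<And>i j. cnj (M i j) = M j i"
    and "i < N" "j < N"
  shows "cnj (minv N M i j) = minv N M j i"
proof -
  have K: "(\<Sum>l<N. M k l * cnj (minv N M i l)) = (if k = i then 1 else 0)" if "k < N" for k
  proof -
    have "(\<Sum>l<N. M k l * cnj (minv N M i l)) = cnj (\<Sum>l<N. minv N M i l * M l k)"
      by (simp add: M mult.commute)
    also have "\<dots> = (if k = i then 1 else 0)"
      using minv_mult(2)[OF det \<open>i < N\<close> that] by simp
    finally show ?thesis .
  qed
  have "minv N M j i = (\<Sum>k<N. if k = i then minv N M j k else 0)"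
    using \<open>i < N\<close> by simp
  also have "\<dots> = (\<Sum>k<N. minv N M j k * (\<Sum>l<N. M k l * cnj (minv N M i l)))"
    using K by (intro sum.cong) auto
  also have "\<dots> = (\<Sum>l<N. (\<Sum>k<N. minv N M j k * M k l) * cnj (minv N M i l))"
    unfolding sum_distrib_left sum_distrib_right by (subst sum.swap) (simp add: mult.assoc)
  also have "\<dots> = (\<Sum>l<N. if j = l then cnj (minv N M i l) else 0)"
    using minv_mult(2)[OF det \<open>j < N\<close>] by (intro sum.cong) auto
  also have "\<dots> = cnj (minv N M i j)"
    using \<open>j < N\<close> by simp
  finally show ?thesis by simp
qed

section \<open>Determinant of a rank-one perturbation\<close>

lemma det_rank_one_update:
  assumes det: "det (mat N N (\<lambda>(i, j). M i j)) \<noteq> 0"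
  shows "det (mat N N (\<lambda>(i, j). M i j - \<alpha> i * \<beta> j)) = det (mat N N (\<lambda>(i, j). M i j)) * (1 - bil N \<beta> (minv N M) \<alpha>)"
proof -
  \<comment> \<open>Two factorisations of the bordered matrix with blocks \<open>M, \<alpha>, \<beta>, 1\<close>.\<close>
  let ?M = "mat N N (\<lambda>(i, j). M i j)"
  let ?U = "mat N N (\<lambda>(i, j). M i j - \<alpha> i * \<beta> j)"
  let ?a = "mat N 1 (\<lambda>(i, j). \<alpha> i)" and ?b = "mat 1 N (\<lambda>(i, j). \<beta> j)"
  \<comment> \<open>\<open>?w\<close> is M^(-1) \<alpha>, and \<open>?c\<close> is the Schur
    complement of M in the bordered matrix.\<close>
  let ?w = "mat N 1 (\<lambda>(i, j). \<Sum>k<N. minv N M i k * \<alpha> k)"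
  let ?c = "mat 1 1 (\<lambda>(i, j). 1 - bil N \<beta> (minv N M) \<alpha>)"
  have Mw: "(\<Sum>k<N. M i k * (\<Sum>l<N. minv N M k l * \<alpha> l)) = \<alpha> i" if "i < N" for i
  proof -
    have "(\<Sum>k<N. M i k * (\<Sum>l<N. minv N M k l * \<alpha> l)) = (\<Sum>l<N. (\<Sum>k<N. M i k * minv N M k l) * \<alpha> l)"
      unfolding sum_distrib_left sum_distrib_right by (subst sum.swap) (simp add: mult.assoc)
    also have "\<dots> = (\<Sum>l<N. if i = l then \<alpha> l else 0)"
      using minv_mult(1)[OF det that] by (intro sum.cong) auto
    finally show ?thesis using that by simp
  qed
  have bw: "(\<Sum>k<N. \<beta> k * (\<Sum>l<N. minv N M k l * \<alpha> l)) = bil N \<beta> (minv N M) \<alpha>"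
    by (simp add: bil_def sum_distrib_left mult.assoc)
  have 1: "four_block_mat ?U ?a (0\<^sub>m 1 N) (1\<^sub>m 1) * four_block_mat (1\<^sub>m N) (0\<^sub>m N 1) ?b (1\<^sub>m 1)
      = four_block_mat ?M ?a ?b (1\<^sub>m 1)"
  proof -
    have "?U * 1\<^sub>m N + ?a * ?b = ?M"
      by (rule eq_matI) (auto simp: scalar_prod_def)
    moreover have "?U * 0\<^sub>m N 1 + ?a * 1\<^sub>m 1 = ?a"
      by (rule eq_matI) (auto simp: scalar_prod_def)
    moreover have "0\<^sub>m 1 N * 1\<^sub>m N + 1\<^sub>m 1 * ?b = ?b"
      by (rule eq_matI) (auto simp: scalar_prod_def)
    moreover have "0\<^sub>m 1 N * 0\<^sub>m N 1 + 1\<^sub>m 1 * 1\<^sub>m 1 = (1\<^sub>m 1 :: complex mat)"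
      by (rule eq_matI) (auto simp: scalar_prod_def)
    ultimately show ?thesis
      by (subst mult_four_block_mat[of _ N N _ 1 _ 1]) auto
  qed
  have 2: "four_block_mat ?M (0\<^sub>m N 1) ?b ?c * four_block_mat (1\<^sub>m N) ?w (0\<^sub>m 1 N) (1\<^sub>m 1)
      = four_block_mat ?M ?a ?b (1\<^sub>m 1)"
  proof -
    have "?M * 1\<^sub>m N + 0\<^sub>m N 1 * 0\<^sub>m 1 N = ?M"
      by (rule eq_matI) (auto simp: scalar_prod_def)
    moreover have "?M * ?w + 0\<^sub>m N 1 * 1\<^sub>m 1 = ?a"
      by (rule eq_matI) (auto simp: scalar_prod_def Mw simp flip: lessThan_atLeast0)
    moreover have "?b * 1\<^sub>m N + ?c * 0\<^sub>m 1 N = ?b"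
      by (rule eq_matI) (auto simp: scalar_prod_def)
    moreover have "?b * ?w + ?c * 1\<^sub>m 1 = 1\<^sub>m 1"
      by (rule eq_matI) (auto simp: scalar_prod_def bw simp flip: lessThan_atLeast0)
    ultimately show ?thesis
      by (subst mult_four_block_mat[of _ N N _ 1 _ 1]) auto
  qed
  have "det (four_block_mat ?U ?a (0\<^sub>m 1 N) (1\<^sub>m 1) * four_block_mat (1\<^sub>m N) (0\<^sub>m N 1) ?b (1\<^sub>m 1)) = det ?U"
    by (subst det_mult[of _ "N + 1"])
      (auto simp: det_four_block_mat_lower_left_zero[of _ N _ 1] det_four_block_mat_upper_right_zero[of _ N _ 1])
  moreover have "det (four_block_mat ?M (0\<^sub>m N 1) ?b ?c * four_block_mat (1\<^sub>m N) ?w (0\<^sub>m 1 N) (1\<^sub>m 1)) = det ?M * det ?c"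
    by (subst det_mult[of _ "N + 1"])
      (auto simp: det_four_block_mat_lower_left_zero[of _ N _ 1] det_four_block_mat_upper_right_zero[of _ N _ 1])
  moreover have "det ?c = 1 - bil N \<beta> (minv N M) \<alpha>"
    by (simp add: det_single)
  ultimately show ?thesis
    unfolding 1 2 by simp
qed

section \<open>Derivatives of determinants and inverses\<close>

lemma has_vector_derivative_eventually_eq:
  assumes "(f has_vector_derivative f') (at x)" "\<forall>\<^sub>F z in nhds x. g z = f z"
  shows "(g has_vector_derivative f') (at x)"
  using assms(1) by (subst has_vector_derivative_cong_ev[where g = f])
    (use assms(2) eventually_nhds_x_imp_x[OF assms(2)] in auto)

lemma det_differentiable:
  fixes f :: "nat \<Rightarrow> nat \<Rightarrow> real \<Rightarrow> complex"
  assumes "\<And>i j. f i j differentiable (at s)"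
  shows "(\<lambda>s. det (mat n n (\<lambda>(i, j). f i j s))) differentiable (at s)"
proof -
  have prod: "(\<lambda>s. \<Prod>i\<in>I. f i (p i) s) differentiable (at s)" for p and I :: "nat set"
    by (induction I rule: infinite_finite_induct) (auto intro!: differentiable_mult assms)
  have "(\<lambda>s. det (mat n n (\<lambda>(i, j). f i j s)))
      = (\<lambda>s. \<Sum>p | p permutes {0..<n}. signof p * (\<Prod>i = 0..<n. f i (p i) s))"
    by (auto simp: det_def intro!: ext sum.cong prod.cong arg_cong2[of _ _ _ _ "(*)"]) 
  then show ?thesis
    by (auto intro!: differentiable_sum differentiable_mult prod finite_permutations)
qed

lemma minv_differentiable:
  fixes M :: "nat \<Rightarrow> nat \<Rightarrow> real \<Rightarrow> complex"
  assumes M: "\<And>i j. M i j differentiable (at s)"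
    and "det (mat N N (\<lambda>(i, j). M i j s)) \<noteq> 0" "i < N" "j < N"
  shows "(\<lambda>s. minv N (\<lambda>i j. M i j s) i j) differentiable (at s)"
proof -
  \<comment> \<open>Entry (i, j) of the adjugate is the cofactor (j, i); the index shifts skip row j
    and column i.\<close>
  have "adj_mat (mat N N (\<lambda>(i, j). M i j s)) $$ (i, j) = (-1) ^ (j + i) *
      det (mat (N - 1) (N - 1) (\<lambda>(i', j'). M (if i' < j then i' else Suc i') (if j' < i then j' else Suc j') s))" for s
    using assms(3,4)
    by (auto simp: adj_mat_def cofactor_def mat_delete_def intro!: arg_cong[of _ _ det] eq_matI)
  then show ?thesis
    unfolding minv_def using assms by (auto intro!: differentiable_divide differentiable_mult det_differentiable)
qed

text \<open>Differentiating M J = 1 gives M J' + D J = 0; multiplication by J on the left solves for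
  J'.\<close>

lemma minv_has_vector_derivative:
  fixes M :: "nat \<Rightarrow> nat \<Rightarrow> real \<Rightarrow> complex"
  assumes M: "\<And>i j. (M i j has_vector_derivative D i j) (at s)"
    and det: "det (mat N N (\<lambda>(i, j). M i j s)) \<noteq> 0" and "i < N" "j < N"
  defines "J \<equiv> minv N (\<lambda>i j. M i j s)"
  shows "((\<lambda>s. minv N (\<lambda>i j. M i j s) i j) has_vector_derivative
    - (\<Sum>k<N. \<Sum>l<N. J i k * D k l * J l j)) (at s)"
proof -
  have Md: "M i j differentiable (at s)" for i j
    using M by (rule differentiableI_vector)
  define J' where "J' k l = vector_derivative (\<lambda>s. minv N (\<lambda>i j. M i j s) k l) (at s)" for k l
  have J': "((\<lambda>s. minv N (\<lambda>i j. M i j s) k l) has_vector_derivative J' k l) (at s)" if "k < N" "l < N" for k l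
    unfolding J'_def using minv_differentiable[of M s, OF Md det that] by (simp add: vector_derivative_works)
  have "continuous (at s) (\<lambda>s. det (mat N N (\<lambda>(i, j). M i j s)))"
    using det_differentiable[OF Md] by (rule differentiable_imp_continuous_within)
  then have "\<forall>\<^sub>F s in nhds s. det (mat N N (\<lambda>(i, j). M i j s)) \<noteq> 0"
    using det by (auto simp: isCont_def tendsto_imp_eventually_ne eventually_nhds_conv_at)
  \<comment> \<open>M J = 1 holds only where the determinant is nonzero; to be differentiated it is
    needed on a neighbourhood.\<close>
  then have ev: "\<forall>\<^sub>F s in nhds s. (\<Sum>l<N. M k l s * minv N (\<lambda>i j. M i j s) l j) = (if k = j then 1 else 0)" if "k < N" for k
    by eventually_elim (use minv_mult(1) that \<open>j < N\<close> in blast)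
  have eq: "(\<Sum>l<N. M k l s * J' l j + D k l * J l j) = 0" if "k < N" for k
  proof -
    have "((\<lambda>s. \<Sum>l<N. M k l s * minv N (\<lambda>i j. M i j s) l j) has_vector_derivative
        (\<Sum>l<N. M k l s * J' l j + D k l * J l j)) (at s)"
      unfolding J_def by (intro has_vector_derivative_sum has_vector_derivative_mult M J') (use \<open>j < N\<close> in auto)
    moreover have "((\<lambda>s. \<Sum>l<N. M k l s * minv N (\<lambda>i j. M i j s) l j) has_vector_derivative 0) (at s)"
      by (rule has_vector_derivative_eventually_eq[OF has_vector_derivative_const ev[OF that]])
    ultimately show ?thesis
      by (rule vector_derivative_unique_at)
  qed
  have "0 = (\<Sum>k<N. J i k * (\<Sum>l<N. M k l s * J' l j + D k l * J l j))"
    using eq by simp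
  also have "\<dots> = (\<Sum>l<N. (\<Sum>k<N. J i k * M k l s) * J' l j) + (\<Sum>k<N. \<Sum>l<N. J i k * D k l * J l j)"
    unfolding sum.distrib distrib_left sum_distrib_left sum_distrib_right by (subst (2) sum.swap) (simp add: mult.assoc)
  also have "(\<Sum>l<N. (\<Sum>k<N. J i k * M k l s) * J' l j) = (\<Sum>l<N. if i = l then J' l j else 0)"
    unfolding J_def using minv_mult(2)[OF det \<open>i < N\<close>] by (intro sum.cong) auto
  also have "\<dots> = J' i j"
    using \<open>i < N\<close> by simp
  finally have "J' i j = - (\<Sum>k<N. \<Sum>l<N. J i k * D k l * J l j)"
    by (simp add: eq_neg_iff_add_eq_0)
  with J'[OF \<open>i < N\<close> \<open>j < N\<close>] show ?thesis by simp
qed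

section \<open>Contractions with two copies of the inverse\<close>

definition sandwich :: "nat \<Rightarrow> (nat \<Rightarrow> complex) \<Rightarrow> (nat \<Rightarrow> nat \<Rightarrow> complex) \<Rightarrow> (nat \<Rightarrow> nat \<Rightarrow> complex) \<Rightarrow> (nat \<Rightarrow> complex) \<Rightarrow> complex" where
  "sandwich N \<beta> J D \<alpha> = (\<Sum>k<N. \<Sum>l<N. (\<Sum>i<N. \<beta> i * J i k) * D k l * (\<Sum>j<N. J l j * \<alpha> j))"

text \<open>For rank-one D the form \<beta>^T J D J \<alpha> splits, so derivatives of bilinear
  forms are again polynomials in such forms.\<close>

lemma sandwich_rank_one: "sandwich N \<beta> J (\<lambda>k l. f k * g l) \<alpha> = bil N \<beta> J f * bil N g J \<alpha>"
proof -
  have "bil N \<beta> J f = (\<Sum>k<N. (\<Sum>i<N. \<beta> i * J i k) * f k)"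
    unfolding bil_def sum_distrib_right by (rule sum.swap)
  moreover have "bil N g J \<alpha> = (\<Sum>l<N. g l * (\<Sum>j<N. J l j * \<alpha> j))"
    by (simp add: bil_def sum_distrib_left mult.assoc)
  ultimately show ?thesis
    by (simp add: sandwich_def sum_product mult.assoc)
qed

lemma sandwich_linear:
  "sandwich N \<beta> J (\<lambda>k l. D k l + E k l) \<alpha> = sandwich N \<beta> J D \<alpha> + sandwich N \<beta> J E \<alpha>"
  "sandwich N \<beta> J (\<lambda>k l. D k l - E k l) \<alpha> = sandwich N \<beta> J D \<alpha> - sandwich N \<beta> J E \<alpha>"
  "sandwich N \<beta> J (\<lambda>k l. c * D k l) \<alpha> = c * sandwich N \<beta> J D \<alpha>"
  by (simp_all add: sandwich_def algebra_simps sum.distrib sum_subtractf sum_distrib_left)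

lemma bil_linear:
  "bil N \<beta> J (\<lambda>k. f k + g k) = bil N \<beta> J f + bil N \<beta> J g"
  "bil N \<beta> J (\<lambda>k. f k - g k) = bil N \<beta> J f - bil N \<beta> J g"
  "bil N \<beta> J (\<lambda>k. c * f k) = c * bil N \<beta> J f"
  "bil N (\<lambda>k. f k + g k) J \<beta> = bil N f J \<beta> + bil N g J \<beta>"
  "bil N (\<lambda>k. f k - g k) J \<beta> = bil N f J \<beta> - bil N g J \<beta>"
  "bil N (\<lambda>k. c * f k) J \<beta> = c * bil N f J \<beta>"
  by (simp_all add: bil_def algebra_simps sum.distrib sum_subtractf sum_distrib_left)

text \<open>The product rule with J' = - J D J.\<close>

lemma bil_has_vector_derivative:
  fixes M :: "nat \<Rightarrow> nat \<Rightarrow> real \<Rightarrow> complex"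
  assumes M: "\<And>i j. (M i j has_vector_derivative D i j) (at s)"
    and det: "det (mat N N (\<lambda>(i, j). M i j s)) \<noteq> 0"
    and \<alpha>: "\<And>i. ((\<lambda>s. \<alpha> s i) has_vector_derivative \<alpha>' i) (at s)"
    and \<beta>: "\<And>i. ((\<lambda>s. \<beta> s i) has_vector_derivative \<beta>' i) (at s)"
  defines "J \<equiv> minv N (\<lambda>i j. M i j s)"
  shows "((\<lambda>s. bil N (\<beta> s) (minv N (\<lambda>i j. M i j s)) (\<alpha> s)) has_vector_derivative
    bil N \<beta>' J (\<alpha> s) + bil N (\<beta> s) J \<alpha>' - sandwich N (\<beta> s) J D (\<alpha> s)) (at s)"
proof -
  let ?K = "\<lambda>i j. \<Sum>k<N. \<Sum>l<N. J i k * D k l * J l j"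
  have "((\<lambda>s. bil N (\<beta> s) (minv N (\<lambda>i j. M i j s)) (\<alpha> s)) has_vector_derivative
    (\<Sum>i<N. \<Sum>j<N. (\<beta> s i * J i j) * \<alpha>' j + (\<beta> s i * - ?K i j + \<beta>' i * J i j) * \<alpha> s j)) (at s)"
    unfolding bil_def J_def
    by (intro has_vector_derivative_sum has_vector_derivative_mult \<alpha> \<beta> minv_has_vector_derivative M det) auto
  moreover have "(\<Sum>i<N. \<Sum>j<N. \<beta> s i * ?K i j * \<alpha> s j) = sandwich N (\<beta> s) J D (\<alpha> s)"
  proof -
    have "(\<Sum>i<N. \<Sum>j<N. \<beta> s i * ?K i j * \<alpha> s j) = (\<Sum>i<N. \<Sum>j<N. \<Sum>k<N. \<Sum>l<N. \<beta> s i * J i k * D k l * (J l j * \<alpha> s j))"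
      by (simp add: sum_distrib_left sum_distrib_right mult.assoc)
    also have "\<dots> = (\<Sum>i<N. \<Sum>k<N. \<Sum>j<N. \<Sum>l<N. \<beta> s i * J i k * D k l * (J l j * \<alpha> s j))"
      by (intro sum.cong refl sum.swap)
    also have "\<dots> = (\<Sum>k<N. \<Sum>i<N. \<Sum>j<N. \<Sum>l<N. \<beta> s i * J i k * D k l * (J l j * \<alpha> s j))"
      by (rule sum.swap)
    also have "\<dots> = (\<Sum>k<N. \<Sum>i<N. \<Sum>l<N. \<Sum>j<N. \<beta> s i * J i k * D k l * (J l j * \<alpha> s j))"
      by (intro sum.cong refl sum.swap)
    also have "\<dots> = (\<Sum>k<N. \<Sum>l<N. \<Sum>i<N. \<Sum>j<N. \<beta> s i * J i k * D k l * (J l j * \<alpha> s j))"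
      by (intro sum.cong refl sum.swap)
    also have "\<dots> = sandwich N (\<beta> s) J D (\<alpha> s)"
      by (simp add: sandwich_def sum_distrib_left sum_distrib_right mult.assoc) (intro sum.cong refl sum.swap)
    finally show ?thesis .
  qed
  ultimately show ?thesis
    by (simp add: bil_def algebra_simps sum.distrib sum_subtractf sum_negf)
qed

text \<open>For D = C M the product J D J is J C.\<close>

lemma sandwich_inverse_left:
  assumes det: "det (mat N N (\<lambda>(i, j). M i j)) \<noteq> 0"
  shows "sandwich N \<beta> (minv N M) (\<lambda>k l. \<Sum>m<N. C k m * M m l) \<alpha> = bil N \<beta> (minv N M) (\<lambda>k. \<Sum>m<N. C k m * \<alpha> m)"
proof -
  let ?J = "minv N M"
  have w: "(\<Sum>l<N. M m l * (\<Sum>j<N. ?J l j * \<alpha> j)) = \<alpha> m" if "m < N" for m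
  proof -
    have "(\<Sum>l<N. M m l * (\<Sum>j<N. ?J l j * \<alpha> j)) = (\<Sum>j<N. (\<Sum>l<N. M m l * ?J l j) * \<alpha> j)"
      unfolding sum_distrib_left sum_distrib_right by (subst sum.swap) (simp add: mult.assoc)
    also have "\<dots> = (\<Sum>j<N. if m = j then \<alpha> j else 0)"
      using minv_mult(1)[OF det that] by (intro sum.cong) auto
    finally show ?thesis using that by simp
  qed
  have "sandwich N \<beta> ?J (\<lambda>k l. \<Sum>m<N. C k m * M m l) \<alpha>
    = (\<Sum>k<N. \<Sum>l<N. \<Sum>m<N. (\<Sum>i<N. \<beta> i * ?J i k) * (C k m * (M m l * (\<Sum>j<N. ?J l j * \<alpha> j))))"
    by (simp add: sandwich_def sum_distrib_left[of _ "\<lambda>m. C _ m * _ m"] sum_distrib_right[of "\<lambda>m. _ m * (C _ m * _ m)"] mult.assoc)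
  also have "\<dots> = (\<Sum>k<N. \<Sum>m<N. \<Sum>l<N. (\<Sum>i<N. \<beta> i * ?J i k) * (C k m * (M m l * (\<Sum>j<N. ?J l j * \<alpha> j))))"
    by (intro sum.cong refl sum.swap)
  also have "\<dots> = (\<Sum>k<N. \<Sum>m<N. (\<Sum>i<N. \<beta> i * ?J i k) * (C k m * \<alpha> m))"
    by (intro sum.cong refl) (simp add: w flip: sum_distrib_left)
  also have "\<dots> = (\<Sum>k<N. \<Sum>i<N. \<beta> i * ?J i k * (\<Sum>m<N. C k m * \<alpha> m))"
    by (simp flip: sum_distrib_left sum_distrib_right)
  also have "\<dots> = bil N \<beta> ?J (\<lambda>k. \<Sum>m<N. C k m * \<alpha> m)"
    unfolding bil_def by (rule sum.swap)
  finally show ?thesis .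
qed

text \<open>For D = M C^T the product J D J is C^T J.\<close>

lemma sandwich_inverse_right:
  assumes det: "det (mat N N (\<lambda>(i, j). M i j)) \<noteq> 0"
  shows "sandwich N \<beta> (minv N M) (\<lambda>k l. \<Sum>m<N. C l m * M k m) \<alpha> = bil N (\<lambda>l. \<Sum>m<N. C l m * \<beta> m) (minv N M) \<alpha>"
proof -
  let ?J = "minv N M"
  have u: "(\<Sum>k<N. (\<Sum>i<N. \<beta> i * ?J i k) * M k m) = \<beta> m" if "m < N" for m
  proof -
    have "(\<Sum>k<N. (\<Sum>i<N. \<beta> i * ?J i k) * M k m) = (\<Sum>i<N. \<beta> i * (\<Sum>k<N. ?J i k * M k m))"
      unfolding sum_distrib_left sum_distrib_right by (subst sum.swap) (simp add: mult.assoc)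
    also have "\<dots> = (\<Sum>i<N. if i = m then \<beta> i else 0)"
      using minv_mult(2)[OF det _ that] by (intro sum.cong) auto
    finally show ?thesis using that by simp
  qed
  have "sandwich N \<beta> ?J (\<lambda>k l. \<Sum>m<N. C l m * M k m) \<alpha>
    = (\<Sum>k<N. \<Sum>l<N. \<Sum>m<N. (\<Sum>i<N. \<beta> i * ?J i k) * M k m * (C l m * (\<Sum>j<N. ?J l j * \<alpha> j)))"
    by (simp add: sandwich_def sum_distrib_left[of _ "\<lambda>m. C _ m * _ m"] sum_distrib_right[of "\<lambda>m. C _ m * _ m"] ac_simps)
  also have "\<dots> = (\<Sum>l<N. \<Sum>k<N. \<Sum>m<N. (\<Sum>i<N. \<beta> i * ?J i k) * M k m * (C l m * (\<Sum>j<N. ?J l j * \<alpha> j)))"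
    by (rule sum.swap)
  also have "\<dots> = (\<Sum>l<N. \<Sum>m<N. \<Sum>k<N. (\<Sum>i<N. \<beta> i * ?J i k) * M k m * (C l m * (\<Sum>j<N. ?J l j * \<alpha> j)))"
    by (intro sum.cong refl sum.swap)
  also have "\<dots> = (\<Sum>l<N. \<Sum>m<N. \<beta> m * (C l m * (\<Sum>j<N. ?J l j * \<alpha> j)))"
    by (intro sum.cong refl) (simp add: u flip: sum_distrib_right)
  also have "\<dots> = (\<Sum>l<N. (\<Sum>m<N. C l m * \<beta> m) * (\<Sum>j<N. ?J l j * \<alpha> j))"
    by (simp add: sum_distrib_right ac_simps)
  also have "\<dots> = bil N (\<lambda>l. \<Sum>m<N. C l m * \<beta> m) ?J \<alpha>"
    by (simp add: bil_def sum_distrib_left[of "sum _ _"] mult.assoc)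
  finally show ?thesis .
qed

section \<open>The Hirota equation\<close>

text \<open>The Hirota equation for \<phi> = c u divided by c, in abstract symbols:
  \<open>d1\<close>, \<open>d2\<close>, \<open>d3\<close> are iterated x-derivatives,
  \<open>dt\<close> is the t-derivative of \<open>s (- 1) 0\<close>, and \<open>ub\<close> stands
  for the conjugate of \<open>u\<close>. The term -2 u arises from the factor e^(2\<i>t) in
  c.\<close>

lemma hirota_identity:
  fixes s :: "int \<Rightarrow> int \<Rightarrow> complex" and v :: complex
  assumes R: "\<And>k. s 0 (k + 1) + s 0 (k - 1) + s 1 k + s (- 1) k = s 0 0 * s 0 k + s 0 (- 1) * s (- 1) k"
  defines "d1 \<equiv> \<lambda>j k. s (j + 1) k + s j (k + 1) - s j 0 * s 0 k"
  defines "d2 \<equiv> \<lambda>j k. d1 (j + 1) k + d1 j (k + 1) - (s j 0 * d1 0 k + d1 j 0 * s 0 k)"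
  defines "d3 \<equiv> \<lambda>j k. d2 (j + 1) k + d2 j (k + 1) - ((s j 0 * d2 0 k + d1 j 0 * d1 0 k) + (d1 j 0 * d1 0 k + d2 j 0 * s 0 k))"
  defines "dt \<equiv> - \<i> * s 1 0 - v * s 2 0 - 3 * v * s 0 0
    + (\<i> * s (- 1) 2 - v * s (- 1) 3 - 3 * v * s (- 1) 1)
    - (\<i> * (s (- 1) 1 * s 0 0) - \<i> * (s (- 1) 0 * s 1 0) - v * (s (- 1) 2 * s 0 0)
       + v * (s (- 1) 1 * s 1 0) - v * (s (- 1) 0 * s 2 0) - 3 * v * (s (- 1) 0 * s 0 0))"
  defines "u \<equiv> 1 - s (- 1) 0" and "ub \<equiv> 1 - s 0 (- 1)"
  shows "- (\<i> * dt) - 2 * u - d2 (- 1) 0 + 2 * (u * ub) * u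
    - \<i> * v * d3 (- 1) 0 - 6 * \<i> * v * (u * ub) * d1 (- 1) 0 = 0"
proof -
  have R0: "s 0 1 = s 0 0 * s 0 0 + s 0 (- 1) * s (- 1) 0 - s 0 (- 1) - s 1 0 - s (- 1) 0"
    using R[of 0] by (simp add: algebra_simps eq_diff_eq)
  have R1: "s 0 2 = s 0 0 * s 0 1 + s 0 (- 1) * s (- 1) 1 - s 0 0 - s 1 1 - s (- 1) 1"
    using R[of 1] by (simp add: algebra_simps eq_diff_eq)
  have [simp]: "\<i> * (\<i> * z) = - z" for z
    by (simp flip: mult.assoc)
  show ?thesis
    unfolding d3_def d2_def d1_def dt_def u_def ub_def
    \<comment> \<open>\<open>R1\<close> comes first: its right side contains \<open>s 0 1\<close>,
      which \<open>R0\<close> then eliminates.\<close>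
    by (simp add: R1) (simp add: R0 algebra_simps)
qed

section \<open>The functions \<open>S_j_k\<close> of the overview and their relations\<close>

definition response :: "real \<Rightarrow> (nat \<Rightarrow> complex) \<Rightarrow> nat \<Rightarrow> int \<Rightarrow> int \<Rightarrow> real \<Rightarrow> real \<Rightarrow> complex" where
  "response v a N j k x t = bil N (phi (- \<i>) v (cnj \<circ> a) j x t) (minv N (gram v a x t)) (phi \<i> v a k x t)"

text \<open>The shifted terms come from the two vectors, the product from the rank-one derivative of
  M.\<close>

lemma response_dx:
  assumes "det (mat N N (\<lambda>(i, j). gram v a x t i j)) \<noteq> 0"
  shows "((\<lambda>x. response v a N j k x t) has_vector_derivative
    response v a N (j + 1) k x t + response v a N j (k + 1) x t
      - response v a N j 0 x t * response v a N 0 k x t) (at x)"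
  using bil_has_vector_derivative[where M = "\<lambda>i j x. gram v a x t i j", OF gram_dx assms phi_dx phi_dx]
  by (simp add: response_def sandwich_rank_one)

lemma response_dt:
  assumes "det (mat N N (\<lambda>(i, j). gram v a x t i j)) \<noteq> 0"
  defines "s \<equiv> \<lambda>j k. response v a N j k x t"
  shows "((\<lambda>t. response v a N j k x t) has_vector_derivative
     - \<i> * s (j + 2) k - of_real v * s (j + 3) k - 3 * of_real v * s (j + 1) k
     + (\<i> * s j (k + 2) - of_real v * s j (k + 3) - 3 * of_real v * s j (k + 1))
     - (\<i> * (s j 1 * s 0 k) - \<i> * (s j 0 * s 1 k) - of_real v * (s j 2 * s 0 k)
       + of_real v * (s j 1 * s 1 k) - of_real v * (s j 0 * s 2 k) - 3 * of_real v * (s j 0 * s 0 k))) (at t)"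
  using bil_has_vector_derivative[where M = "\<lambda>i j t. gram v a x t i j", OF gram_dt assms(1)
      phi_dt[of \<i> v a k x] phi_dt[of "- \<i>" v "cnj \<circ> a" j x]]
  by (simp only: response_def s_def sandwich_rank_one sandwich_linear bil_linear)

text \<open>The identity for C M + M C^T is contracted with J on both sides. C shifts the index of
  each vector up and down, and the two rank-one terms give the products.\<close>

lemma response_toeplitz:
  assumes "det (mat N N (\<lambda>(i, j). gram v a x t i j)) \<noteq> 0"
  defines "s \<equiv> \<lambda>j k. response v a N j k x t"
  shows "s j (k + 1) + s j (k - 1) + s (j + 1) k + s (j - 1) k = s j 0 * s 0 k + s j (- 1) * s (- 1) k"
proof -
  let ?P = "\<lambda>k. phi \<i> v a k x t" and ?Q = "\<lambda>k. phi (- \<i>) v (cnj \<circ> a) k x t"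
  let ?M = "gram v a x t"
  let ?J = "minv N ?M"
  have "sandwich N (?Q j) ?J (\<lambda>i l. (\<Sum>m<N. toeplitz i m * ?M m l) + (\<Sum>m<N. toeplitz l m * ?M i m)) (?P k)
    = sandwich N (?Q j) ?J (\<lambda>i l. ?P 0 i * ?Q 0 l + ?P (- 1) i * ?Q (- 1) l) (?P k)"
    unfolding sandwich_def by (intro sum.cong refl) (simp add: gram_toeplitz)
  moreover have "bil N (?Q j) ?J (\<lambda>i. \<Sum>m<N. toeplitz i m * ?P k m) = s j (k + 1) + s j (k - 1)"
    unfolding s_def response_def bil_linear(1)[symmetric]
    unfolding bil_def by (intro sum.cong refl) (simp add: phi_toeplitz)
  moreover have "bil N (\<lambda>i. \<Sum>m<N. toeplitz i m * ?Q j m) ?J (?P k) = s (j + 1) k + s (j - 1) k"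
    unfolding s_def response_def bil_linear(4)[symmetric]
    unfolding bil_def by (intro sum.cong refl) (simp add: phi_toeplitz)
  ultimately show ?thesis
    by (simp add: sandwich_linear sandwich_rank_one sandwich_inverse_left[OF assms(1)]
        sandwich_inverse_right[OF assms(1)] s_def response_def add.assoc)
qed

text \<open>Conjugation exchanges the vectors \<phi> and \<psi> and transposes the Hermitian
  inverse.\<close>

lemma response_cnj:
  assumes "det (mat N N (\<lambda>(i, j). gram v a x t i j)) \<noteq> 0"
  shows "cnj (response v a N j k x t) = response v a N k j x t"
proof -
  have a: "cnj \<circ> (cnj \<circ> a) = a" by (simp add: fun_eq_iff)
  have "cnj (response v a N j k x t)
      = (\<Sum>i<N. \<Sum>l<N. phi \<i> v a j x t i * minv N (gram v a x t) l i * phi (- \<i>) v (cnj \<circ> a) k x t l)"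
    unfolding response_def bil_def cnj_sum complex_cnj_mult
    by (intro sum.cong refl) (simp add: phi_cnj minv_cnj[OF assms gram_cnj] a)
  also have "\<dots> = response v a N k j x t"
    unfolding response_def bil_def by (subst sum.swap) (simp add: ac_simps)
  finally show ?thesis .
qed

section \<open>Tau functions in terms of \<open>response\<close>\<close>

lemma
  fixes v x t a
  defines "c \<equiv> exp (fps_nth (zeta \<i> v x t + zeta (- \<i>) v x t) 0)"
  shows det_gram: "det (mat N N (\<lambda>(i, j). gram v a x t i j)) = c ^ N * tau v a N 0 x t"
    and tau_1: "tau v a N 0 x t \<noteq> 0 \<Longrightarrow>
      tau v a N 1 x t = (-1) ^ N * tau v a N 0 x t * (1 - response v a N (- 1) 0 x t)"
proof -
  have smult: "det (mat N N (\<lambda>(i, j). f i j * d)) = d ^ N * det (mat N N (\<lambda>(i, j). f i j))" for f and d :: complex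
  proof -
    have "mat N N (\<lambda>(i, j). f i j * d) = d \<cdot>\<^sub>m mat N N (\<lambda>(i, j). f i j)"
      by (rule eq_matI) auto
    then show ?thesis by simp
  qed
  show g: "det (mat N N (\<lambda>(i, j). gram v a x t i j)) = c ^ N * tau v a N 0 x t"
    unfolding tau_def smult[symmetric] c_def gram_mEntry_0 ..
  assume "tau v a N 0 x t \<noteq> 0"
  then have nz: "det (mat N N (\<lambda>(i, j). gram v a x t i j)) \<noteq> 0"
    by (simp add: g c_def)
  \<comment> \<open>By \<open>gram_mEntry_1\<close> the matrix for n = 1 is, up to the scalar c,
    minus a rank-one update of M; the N rows give the sign.\<close>
  have "c ^ N * tau v a N 1 x t
      = det (mat N N (\<lambda>(i, j). (gram v a x t i j - phi \<i> v a 0 x t i * phi (- \<i>) v (cnj \<circ> a) (- 1) x t j) * (- 1)))"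
    unfolding tau_def smult[symmetric] c_def gram_mEntry_1 by simp
  also have "\<dots> = (- 1) ^ N * (c ^ N * tau v a N 0 x t * (1 - response v a N (- 1) 0 x t))"
    unfolding smult det_rank_one_update[OF nz] response_def by (simp only: g)
  finally have "c ^ N * tau v a N 1 x t = c ^ N * ((- 1) ^ N * tau v a N 0 x t * (1 - response v a N (- 1) 0 x t))"
    by (simp add: ac_simps)
  then show "tau v a N 1 x t = (-1) ^ N * tau v a N 0 x t * (1 - response v a N (- 1) 0 x t)"
    by (simp add: c_def)
qed

text \<open>Up to a nonvanishing factor this is the determinant of \<open>gram\<close>, which is
  continuous in each variable.\<close>

lemma eventually_tau_nonzero:
  assumes "tau v a N 0 x t \<noteq> 0"
  shows "\<forall>\<^sub>F z in nhds x. tau v a N 0 z t \<noteq> 0" "\<forall>\<^sub>F z in nhds t. tau v a N 0 x z \<noteq> 0"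
proof -
  have nz: "det (mat N N (\<lambda>(i, j). gram v a x t i j)) \<noteq> 0"
    using assms by (simp add: det_gram)
  have "isCont (\<lambda>z. det (mat N N (\<lambda>(i, j). gram v a z t i j))) x"
    by (intro differentiable_imp_continuous_within det_differentiable differentiableI_vector[OF gram_dx])
  then have "\<forall>\<^sub>F z in nhds x. det (mat N N (\<lambda>(i, j). gram v a z t i j)) \<noteq> 0"
    using nz by (auto simp: isCont_def tendsto_imp_eventually_ne eventually_nhds_conv_at)
  then show "\<forall>\<^sub>F z in nhds x. tau v a N 0 z t \<noteq> 0"
    by eventually_elim (simp add: det_gram)
  have "isCont (\<lambda>z. det (mat N N (\<lambda>(i, j). gram v a x z i j))) t"
    by (intro differentiable_imp_continuous_within det_differentiable differentiableI_vector[OF gram_dt])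
  then have "\<forall>\<^sub>F z in nhds t. det (mat N N (\<lambda>(i, j). gram v a x z i j)) \<noteq> 0"
    using nz by (auto simp: isCont_def tendsto_imp_eventually_ne eventually_nhds_conv_at)
  then show "\<forall>\<^sub>F z in nhds t. tau v a N 0 x z \<noteq> 0"
    by eventually_elim (simp add: det_gram)
qed

lemma phiN_eq:
  assumes "tau v a N 0 x t \<noteq> 0"
  shows "phiN v a N x t = (-1) ^ N * exp (2 * \<i> * of_real t) * (1 - response v a N (- 1) 0 x t)"
  using assms unfolding phiN_def tau_1[OF assms] by simp

theorem mainTheorem1:
  fixes v :: real and N :: nat and a :: "nat \<Rightarrow> complex" and x t :: real
  assumes "N \<ge> 1"
    and "tau v a N 0 x t \<noteq> 0"
  defines "\<phi> \<equiv> phiN v a N"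
  shows "(\<lambda>s. \<phi> x s) differentiable (at t)
    \<and> (\<forall>\<^sub>F y in nhds x. (\<lambda>z. \<phi> z t) differentiable (at y))
    \<and> (\<forall>\<^sub>F y in nhds x. (\<lambda>z. Dx \<phi> z t) differentiable (at y))
    \<and> (\<lambda>z. Dx (Dx \<phi>) z t) differentiable (at x)
    \<and> \<i> * Dt \<phi> x t + Dx (Dx \<phi>) x t + 2 * of_real ((cmod (\<phi> x t))^2) * \<phi> x t
      + \<i> * of_real v * Dx (Dx (Dx \<phi>)) x t
      + 6 * \<i> * of_real v * of_real ((cmod (\<phi> x t))^2) * Dx \<phi> x t = 0"
proof -
  define nz where "nz z \<longleftrightarrow> tau v a N 0 z t \<noteq> 0" for z
  \<comment> \<open>This factor is constant in x and has modulus 1.\<close>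
  define c where "c = (-1) ^ N * exp (2 * \<i> * of_real t)"
  define s where "s j k z = response v a N j k z t" for j k z
  define d1 where "d1 j k z = s (j + 1) k z + s j (k + 1) z - s j 0 z * s 0 k z" for j k z
  define d2 where "d2 j k z = d1 (j + 1) k z + d1 j (k + 1) z - (s j 0 z * d1 0 k z + d1 j 0 z * s 0 k z)" for j k z
  define d3 where "d3 j k z = d2 (j + 1) k z + d2 j (k + 1) z
    - ((s j 0 z * d2 0 k z + d1 j 0 z * d1 0 k z) + (d1 j 0 z * d1 0 k z + d2 j 0 z * s 0 k z))" for j k z
  \<comment> \<open>Iterating \<open>Dx\<close> needs each formula on a neighbourhood, so
    nonvanishing is propagated to nearby points.\<close>
  have nzx: "nz x" and ev: "nz z \<Longrightarrow> \<forall>\<^sub>F z in nhds z. nz z" for z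
    using assms(2) eventually_tau_nonzero(1) by (auto simp: nz_def)
  have det: "det (mat N N (\<lambda>(i, j). gram v a z t i j)) \<noteq> 0" if "nz z" for z
    using that by (simp add: nz_def det_gram)
  have s: "(s j k has_vector_derivative d1 j k z) (at z)" if "nz z" for j k z
    using response_dx[OF det[OF that]] unfolding s_def[abs_def] d1_def .
  have d1: "(d1 j k has_vector_derivative d2 j k z) (at z)" if "nz z" for j k z
    unfolding d1_def[abs_def] d2_def
    by (intro has_vector_derivative_diff has_vector_derivative_add has_vector_derivative_mult s[OF that, unfolded d1_def])
  have d2: "(d2 j k has_vector_derivative d3 j k z) (at z)" if "nz z" for j k z
    unfolding d2_def[abs_def] d3_def
    by (intro has_vector_derivative_diff has_vector_derivative_add has_vector_derivative_mult s[OF that] d1[OF that, unfolded d2_def])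
  have \<phi>: "\<phi> z t = c * (1 - s (- 1) 0 z)" if "nz z" for z
    using that by (simp add: \<phi>_def phiN_eq nz_def c_def s_def)
  have \<phi>1: "((\<lambda>z. \<phi> z t) has_vector_derivative - c * d1 (- 1) 0 z) (at z)" if "nz z" for z
  proof (rule has_vector_derivative_eventually_eq)
    show "((\<lambda>z. c * (1 - s (- 1) 0 z)) has_vector_derivative - c * d1 (- 1) 0 z) (at z)"
      using s[OF that] by (auto intro!: derivative_eq_intros)
    show "\<forall>\<^sub>F z in nhds z. \<phi> z t = c * (1 - s (- 1) 0 z)"
      using ev[OF that] by eventually_elim (rule \<phi>)
  qed
  then have Dx1: "Dx \<phi> z t = - c * d1 (- 1) 0 z" if "nz z" for z
    unfolding Dx_def using that by (blast intro: vector_derivative_at)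
  have \<phi>2: "((\<lambda>z. Dx \<phi> z t) has_vector_derivative - c * d2 (- 1) 0 z) (at z)" if "nz z" for z
  proof (rule has_vector_derivative_eventually_eq)
    show "((\<lambda>z. - c * d1 (- 1) 0 z) has_vector_derivative - c * d2 (- 1) 0 z) (at z)"
      by (intro has_vector_derivative_mult_right d1 that)
    show "\<forall>\<^sub>F z in nhds z. Dx \<phi> z t = - c * d1 (- 1) 0 z"
      using ev[OF that] by eventually_elim (rule Dx1)
  qed
  then have Dx2: "Dx (Dx \<phi>) z t = - c * d2 (- 1) 0 z" if "nz z" for z
    unfolding Dx_def[of "Dx \<phi>"] using that by (blast intro: vector_derivative_at)
  have \<phi>3: "((\<lambda>z. Dx (Dx \<phi>) z t) has_vector_derivative - c * d3 (- 1) 0 x) (at x)"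
  proof (rule has_vector_derivative_eventually_eq)
    show "((\<lambda>z. - c * d2 (- 1) 0 z) has_vector_derivative - c * d3 (- 1) 0 x) (at x)"
      by (intro has_vector_derivative_mult_right d2 nzx)
    show "\<forall>\<^sub>F z in nhds x. Dx (Dx \<phi>) z t = - c * d2 (- 1) 0 z"
      using ev[OF nzx] by eventually_elim (rule Dx2)
  qed
  then have Dx3: "Dx (Dx (Dx \<phi>)) x t = - c * d3 (- 1) 0 x"
    unfolding Dx_def[of "Dx (Dx \<phi>)"] by (rule vector_derivative_at)
  define S where "S j k = s j k x" for j k
  define dt where "dt = - \<i> * S 1 0 - of_real v * S 2 0 - 3 * of_real v * S 0 0
    + (\<i> * S (- 1) 2 - of_real v * S (- 1) 3 - 3 * of_real v * S (- 1) 1)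
    - (\<i> * (S (- 1) 1 * S 0 0) - \<i> * (S (- 1) 0 * S 1 0) - of_real v * (S (- 1) 2 * S 0 0)
       + of_real v * (S (- 1) 1 * S 1 0) - of_real v * (S (- 1) 0 * S 2 0) - 3 * of_real v * (S (- 1) 0 * S 0 0))"
  have \<phi>t: "((\<lambda>r. \<phi> x r) has_vector_derivative c * (2 * \<i> * (1 - S (- 1) 0) - dt)) (at t)"
  proof (rule has_vector_derivative_eventually_eq)
    have st: "((\<lambda>r. response v a N (- 1) 0 x r) has_vector_derivative dt) (at t)"
      using response_dt[OF det[OF nzx], of "- 1" 0] by (simp add: dt_def S_def s_def)
    have "((\<lambda>r. exp (2 * \<i> * of_real r)) has_vector_derivative 2 * \<i> * exp (2 * \<i> * of_real t)) (at t)"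
      by (rule field_vector_diff_chain_at[where f = "\<lambda>r. 2 * \<i> * of_real r" and g = exp, unfolded o_def])
        (auto intro!: derivative_eq_intros)
    then have "((\<lambda>r. (-1) ^ N * exp (2 * \<i> * of_real r) * (1 - response v a N (- 1) 0 x r)) has_vector_derivative
        (-1) ^ N * exp (2 * \<i> * of_real t) * (0 - dt)
          + (-1) ^ N * (2 * \<i> * exp (2 * \<i> * of_real t)) * (1 - response v a N (- 1) 0 x t)) (at t)"
      by (intro has_vector_derivative_mult has_vector_derivative_mult_right has_vector_derivative_diff
          has_vector_derivative_const st)
    then show "((\<lambda>r. (-1) ^ N * exp (2 * \<i> * of_real r) * (1 - response v a N (- 1) 0 x r)) has_vector_derivative
        c * (2 * \<i> * (1 - S (- 1) 0) - dt)) (at t)"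
      by (simp add: c_def S_def s_def algebra_simps)
    show "\<forall>\<^sub>F r in nhds t. \<phi> x r = (-1) ^ N * exp (2 * \<i> * of_real r) * (1 - response v a N (- 1) 0 x r)"
      unfolding \<phi>_def using eventually_tau_nonzero(2)[OF assms(2)] by eventually_elim (rule phiN_eq)
  qed
  then have Dt: "Dt \<phi> x t = c * (2 * \<i> * (1 - S (- 1) 0) - dt)"
    unfolding Dt_def by (rule vector_derivative_at)
  have "cmod c = 1"
    by (simp add: c_def norm_mult norm_power)
  then have "c * cnj c = 1"
    by (simp add: complex_norm_square[symmetric])
  \<comment> \<open>The conjugate of S_(-1,0) is S_(0,-1), which makes the squared modulus
    polynomial in the S.\<close>
  have "complex_of_real ((cmod (\<phi> x t))\<^sup>2) = (c * cnj c) * ((1 - S (- 1) 0) * (1 - S 0 (- 1)))"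
    unfolding complex_norm_square \<phi>[OF nzx] using response_cnj[OF det[OF nzx], of "- 1" 0]
    by (simp add: S_def s_def)
  then have modulus: "complex_of_real ((cmod (\<phi> x t))\<^sup>2) = (1 - S (- 1) 0) * (1 - S 0 (- 1))"
    by (simp only: \<open>c * cnj c = 1\<close> mult_1)
  have R: "S 0 (k + 1) + S 0 (k - 1) + S 1 k + S (- 1) k = S 0 0 * S 0 k + S 0 (- 1) * S (- 1) k" for k
    using response_toeplitz[OF det[OF nzx], of 0 k] by (simp add: S_def s_def)
  let ?u = "1 - S (- 1) 0" and ?ub = "1 - S 0 (- 1)"
  have "- (\<i> * dt) - 2 * ?u - d2 (- 1) 0 x + 2 * (?u * ?ub) * ?u
    - \<i> * of_real v * d3 (- 1) 0 x - 6 * \<i> * of_real v * (?u * ?ub) * d1 (- 1) 0 x = 0"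
    using hirota_identity[of S "of_real v", OF R] by (simp only: dt_def d3_def d2_def d1_def S_def)
  \<comment> \<open>Once the squared modulus is rewritten, every term carries exactly one factor
    c.\<close>
  moreover have "\<i> * Dt \<phi> x t + Dx (Dx \<phi>) x t + 2 * of_real ((cmod (\<phi> x t))^2) * \<phi> x t
      + \<i> * of_real v * Dx (Dx (Dx \<phi>)) x t
      + 6 * \<i> * of_real v * of_real ((cmod (\<phi> x t))^2) * Dx \<phi> x t
    = c * (- (\<i> * dt) - 2 * ?u - d2 (- 1) 0 x + 2 * (?u * ?ub) * ?u
      - \<i> * of_real v * d3 (- 1) 0 x - 6 * \<i> * of_real v * (?u * ?ub) * d1 (- 1) 0 x)"
  proof -
    have "\<i> * (\<i> * z) = - z" for z
      by (simp flip: mult.assoc)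
    then have i: "\<i> * (c * (2 * \<i> * y - dt)) = c * (- (\<i> * dt) - 2 * y)" for y
      by (simp add: algebra_simps)
    have *: "c * p + - c * e2 + 2 * m * (c * w) + \<i> * of_real v * (- c * e3) + 6 * \<i> * of_real v * m * (- c * e1)
      = c * (p - e2 + 2 * m * w - \<i> * of_real v * e3 - 6 * \<i> * of_real v * m * e1)" for p e1 e2 e3 m w
      by (simp add: algebra_simps)
    show ?thesis
      unfolding modulus
      unfolding Dt i Dx1[OF nzx] Dx2[OF nzx] Dx3 \<phi>[OF nzx] S_def[symmetric] * ..
  qed
  ultimately have "\<i> * Dt \<phi> x t + Dx (Dx \<phi>) x t + 2 * of_real ((cmod (\<phi> x t))^2) * \<phi> x t
      + \<i> * of_real v * Dx (Dx (Dx \<phi>)) x t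
      + 6 * \<i> * of_real v * of_real ((cmod (\<phi> x t))^2) * Dx \<phi> x t = 0"
    by simp
  moreover have "\<forall>\<^sub>F y in nhds x. (\<lambda>z. \<phi> z t) differentiable (at y)"
    using ev[OF nzx] by eventually_elim (blast intro: differentiableI_vector \<phi>1)
  moreover have "\<forall>\<^sub>F y in nhds x. (\<lambda>z. Dx \<phi> z t) differentiable (at y)"
    using ev[OF nzx] by eventually_elim (blast intro: differentiableI_vector \<phi>2)
  ultimately show ?thesis
    using differentiableI_vector[OF \<phi>t] differentiableI_vector[OF \<phi>3] by blast
qed

end
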